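(* Given a directed acyclic graph $G$ with $n$ vertices and $m$ arcs, and $k$ pairs of vertices of $G$, all lowest common ancestors of all the $k$ given pairs can be found in time $O(n^{\omega} + n(m+k) + n^2 k)$, where $O(n^{\omega})$ is the time needed to compute the transitive closure of $G$.
   Context: All paths are directed, and a single vertex counts as a (trivial) directed path. For distinct vertices $u,v$ of a directed acyclic graph $G$, a vertex $s\in G$ is a junction of $u,v$ if there are internally disjoint directed paths $P$ from $s$ to $u$ and $Q$ from $s$ to $v$ in $G$, where internally disjoint means that $s$ is the only vertex common to $P$ and $Q$. In particular, if $u$ is a proper ancestor of $v$, then $u$ is a junction of $u,v$. By convention no vertex is a junction of a pair $u,u$. A vertex $s$ is a lowest common ancestor (LCA) of $u,v$, $u\neq v$, if $s$ is a junction of $u,v$ and for every junction $s'\neq s$ of $u,v$ there is no directed path in $G$ from $s$ to $s'$. A pair may have several LCAs. Here $\omega<2.376$ is the exponent of fast Boolean matrix multiplication. *)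

theory Defs
  imports Complex_Main "Graph_Theory.Graph_Theory"
begin

section \<open>Junctions and lowest common ancestors\<close>

definition dag :: "('a, 'b) pre_digraph \<Rightarrow> bool" where
  "dag G \<longleftrightarrow> digraph G \<and> acyclic (arcs_ends G)"

text \<open>A vertex list \<open>[x]\<close> with \<open>x\<close> in \<open>verts G\<close> is a \<open>vpath\<close>, so trivial paths are included.\<close>

definition directed_path :: "('a, 'b) pre_digraph \<Rightarrow> 'a \<Rightarrow> 'a list \<Rightarrow> 'a \<Rightarrow> bool" where
  "directed_path G x p y \<longleftrightarrow> vpath p G \<and> hd p = x \<and> last p = y"

text \<open>The condition \<open>u \<noteq> v\<close> implements the convention that a pair \<open>u, u\<close> has no junction;
  such a pair therefore has no lowest common ancestor either.\<close>

definition junction :: "('a, 'b) pre_digraph \<Rightarrow> 'a \<Rightarrow> 'a \<Rightarrow> 'a \<Rightarrow> bool" where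
  "junction G u v s \<longleftrightarrow> u \<noteq> v \<and>
     (\<exists>P Q. directed_path G s P u \<and> directed_path G s Q v \<and> set P \<inter> set Q = {s})"

definition lca :: "('a, 'b) pre_digraph \<Rightarrow> 'a \<Rightarrow> 'a \<Rightarrow> 'a \<Rightarrow> bool" where
  "lca G u v s \<longleftrightarrow> junction G u v s \<and>
     (\<forall>s'. junction G u v s' \<and> s' \<noteq> s \<longrightarrow> \<not> (\<exists>p. directed_path G s p s'))"

section \<open>A word RAM with unit cost\<close>

text \<open>
  Programs over finitely many registers and a random access memory, both holding natural numbers.
  Every operator, constant, register access, memory access, assignment and test costs one unit.
  Overflow is an error: \<open>exec W\<close> has no derivation for a run in which some subexpression
  (in particular some address) evaluates to a number above \<open>W\<close>.
  Below, \<open>W\<close> is polynomial in the input size, i.e. words have logarithmic length.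
\<close>

record state =
  reg :: "nat \<Rightarrow> nat"
  mem :: "nat \<Rightarrow> nat"

datatype binop = Add | Sub | Mul | Div | Less | Equal

datatype exp = Const nat | Reg nat | Load exp | Bin binop exp exp

datatype com =
    Skip
  | Assign nat exp
  | Store exp exp
  | Seq com com
  | If exp com com
  | While exp com

text \<open>Subtraction is truncated at 0, and division by 0 yields 0.\<close>

fun binop_val :: "binop \<Rightarrow> nat \<Rightarrow> nat \<Rightarrow> nat" where
  "binop_val Add x y = x + y"
| "binop_val Sub x y = x - y"
| "binop_val Mul x y = x * y"
| "binop_val Div x y = x div y"
| "binop_val Less x y = of_bool (x < y)"
| "binop_val Equal x y = of_bool (x = y)"

fun exp_val :: "exp \<Rightarrow> state \<Rightarrow> nat" where
  "exp_val (Const c) \<sigma> = c"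
| "exp_val (Reg i) \<sigma> = reg \<sigma> i"
| "exp_val (Load e) \<sigma> = mem \<sigma> (exp_val e \<sigma>)"
| "exp_val (Bin f d e) \<sigma> = binop_val f (exp_val d \<sigma>) (exp_val e \<sigma>)"

fun exp_cost :: "exp \<Rightarrow> nat" where
  "exp_cost (Const c) = 1"
| "exp_cost (Reg i) = 1"
| "exp_cost (Load e) = exp_cost e + 1"
| "exp_cost (Bin f d e) = exp_cost d + exp_cost e + 1"

fun exp_fits :: "nat \<Rightarrow> exp \<Rightarrow> state \<Rightarrow> bool" where
  "exp_fits W (Const c) \<sigma> \<longleftrightarrow> c \<le> W"
| "exp_fits W (Reg i) \<sigma> \<longleftrightarrow> reg \<sigma> i \<le> W"
| "exp_fits W (Load e) \<sigma> \<longleftrightarrow> exp_fits W e \<sigma> \<and> exp_val (Load e) \<sigma> \<le> W"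
| "exp_fits W (Bin f d e) \<sigma> \<longleftrightarrow>
     exp_fits W d \<sigma> \<and> exp_fits W e \<sigma> \<and> exp_val (Bin f d e) \<sigma> \<le> W"

text \<open>\<open>exec W c \<sigma> t \<tau>\<close>: started in \<open>\<sigma>\<close>, the program \<open>c\<close> halts after \<open>t\<close> steps in \<open>\<tau>\<close>.\<close>

inductive exec :: "nat \<Rightarrow> com \<Rightarrow> state \<Rightarrow> nat \<Rightarrow> state \<Rightarrow> bool" for W where
  Skip: "exec W Skip \<sigma> 1 \<sigma>"
| Assign: "exp_fits W e \<sigma> \<Longrightarrow>
    exec W (Assign i e) \<sigma> (exp_cost e + 1) (\<sigma>\<lparr>reg := (reg \<sigma>)(i := exp_val e \<sigma>)\<rparr>)"
| Store: "exp_fits W a \<sigma> \<Longrightarrow> exp_fits W e \<sigma> \<Longrightarrow>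
    exec W (Store a e) \<sigma> (exp_cost a + exp_cost e + 1)
      (\<sigma>\<lparr>mem := (mem \<sigma>)(exp_val a \<sigma> := exp_val e \<sigma>)\<rparr>)"
| Seq: "exec W c \<sigma> t \<sigma>' \<Longrightarrow> exec W d \<sigma>' t' \<sigma>'' \<Longrightarrow> exec W (Seq c d) \<sigma> (t + t') \<sigma>''"
| IfTrue: "exp_fits W e \<sigma> \<Longrightarrow> exp_val e \<sigma> \<noteq> 0 \<Longrightarrow> exec W c \<sigma> t \<sigma>' \<Longrightarrow>
    exec W (If e c d) \<sigma> (exp_cost e + 1 + t) \<sigma>'"
| IfFalse: "exp_fits W e \<sigma> \<Longrightarrow> exp_val e \<sigma> = 0 \<Longrightarrow> exec W d \<sigma> t \<sigma>' \<Longrightarrow>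
    exec W (If e c d) \<sigma> (exp_cost e + 1 + t) \<sigma>'"
| WhileTrue: "exp_fits W e \<sigma> \<Longrightarrow> exp_val e \<sigma> \<noteq> 0 \<Longrightarrow> exec W c \<sigma> t \<sigma>' \<Longrightarrow>
    exec W (While e c) \<sigma>' t' \<sigma>'' \<Longrightarrow> exec W (While e c) \<sigma> (exp_cost e + 1 + t + t') \<sigma>''"
| WhileFalse: "exp_fits W e \<sigma> \<Longrightarrow> exp_val e \<sigma> = 0 \<Longrightarrow>
    exec W (While e c) \<sigma> (exp_cost e + 1) \<sigma>"

text \<open>The arguments are in the first registers and the data at the start of the memory;
  everything else is 0.\<close>

definition initial_state :: "nat list \<Rightarrow> nat list \<Rightarrow> state" where
  "initial_state args xs =
     \<lparr>reg = (\<lambda>i. if i < length args then args ! i else 0),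
      mem = (\<lambda>i. if i < length xs then xs ! i else 0)\<rparr>"

text \<open>
  One program solves all valid instances, within \<open>O(T)\<close> steps and with words bounded by a
  polynomial in the instance size.
\<close>

definition solvable_in_time ::
  "('i \<Rightarrow> bool) \<Rightarrow> ('i \<Rightarrow> nat) \<Rightarrow> ('i \<Rightarrow> state) \<Rightarrow> ('i \<Rightarrow> state \<Rightarrow> bool) \<Rightarrow> ('i \<Rightarrow> real) \<Rightarrow> bool" where
  "solvable_in_time valid isize input correct T \<longleftrightarrow>
     (\<exists>prog w d C. \<forall>I. valid I \<longrightarrow>
        (\<exists>t \<tau>. exec (w * (isize I + 1) ^ d) prog (input I) t \<tau> \<and> correct I \<tau> \<and>
               real t \<le> C * T I))"

section \<open>The two computational problems\<close>

text \<open>A graph on the vertices \<open>0, \<dots>, n - 1\<close> is given by the list of its arcs, in any order.\<close>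

definition arc_digraph :: "nat \<Rightarrow> (nat \<times> nat) list \<Rightarrow> (nat, nat \<times> nat) pre_digraph" where
  "arc_digraph n as = with_proj \<lparr>pverts = {..<n}, parcs = set as\<rparr>"

definition dag_input :: "nat \<Rightarrow> (nat \<times> nat) list \<Rightarrow> bool" where
  "dag_input n as \<longleftrightarrow> 0 < n \<and> distinct as \<and> dag (arc_digraph n as)"

definition flatten_pairs :: "(nat \<times> nat) list \<Rightarrow> nat list" where
  "flatten_pairs ps = concat (map (\<lambda>(x, y). [x, y]) ps)"

text \<open>Output of transitive closure: a row-major matrix whose address is in register 0.\<close>

definition transitive_closure_in_time :: "(nat \<Rightarrow> real) \<Rightarrow> bool" where
  "transitive_closure_in_time T \<longleftrightarrow>
     solvable_in_time
       (\<lambda>(n, as). dag_input n as)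
       (\<lambda>(n, as). n + length as)
       (\<lambda>(n, as). initial_state [n, length as] (flatten_pairs as))
       (\<lambda>(n, as) \<tau>. \<forall>i<n. \<forall>j<n.
          mem \<tau> (reg \<tau> 0 + n * i + j) = of_bool ((i, j) \<in> (arcs_ends (arc_digraph n as))\<^sup>+))
       (\<lambda>(n, as). T n)"

definition stored_list :: "state \<Rightarrow> nat \<Rightarrow> nat list" where
  "stored_list \<sigma> p = map (\<lambda>j. mem \<sigma> (p + 1 + j)) [0..<mem \<sigma> p]"

text \<open>
  Output of the LCA problem: register 0 holds the address of a table with one pointer per
  given pair, leading to a length-prefixed list of all LCAs of that pair, without repetitions.
  The time bound is a function of the numbers of vertices, arcs and given pairs.
\<close>

definition all_lcas_in_time :: "(nat \<Rightarrow> nat \<Rightarrow> nat \<Rightarrow> real) \<Rightarrow> bool" where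
  "all_lcas_in_time T \<longleftrightarrow>
     solvable_in_time
       (\<lambda>(n, as, ps). dag_input n as \<and> set ps \<subseteq> {..<n} \<times> {..<n})
       (\<lambda>(n, as, ps). n + length as + length ps)
       (\<lambda>(n, as, ps). initial_state [n, length as, length ps] (flatten_pairs (as @ ps)))
       (\<lambda>(n, as, ps) \<tau>. \<forall>i<length ps.
          let xs = stored_list \<tau> (mem \<tau> (reg \<tau> 0 + i)); (u, v) = ps ! i
          in distinct xs \<and> set xs = {s. lca (arc_digraph n as) u v s})
       (\<lambda>(n, as, ps). T n (length as) (length ps))"

end

theory Submission
  imports Defs
begin

text \<open>
  In a dag every common ancestor reaches a junction, and a lowest common ancestor is itself a
  junction: a second common vertex of the two paths would be a lower common ancestor. Hence the
  LCAs of \<open>u \<noteq> v\<close> are exactly the common ancestors without an out-neighbour that is a common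
  ancestor. With an adjacency matrix, two backward searches and one scan over the matrix find
  them in time \<open>O(n\<^sup>2)\<close> per pair, so \<open>O(m + n\<^sup>2k)\<close> steps suffice. This is within the bound
  without computing a transitive closure; that algorithm only enters through \<open>\<omega> \<ge> 0\<close>, which
  holds because each of its runs takes at least one step and which gives \<open>1 \<le> n powr \<omega>\<close>
  for the constant overhead when \<open>k = 0\<close>.
\<close>

section \<open>Lowest junctions are lowest common ancestors\<close>

text \<open>For \<open>k = 0\<close> the bound leaves only \<open>real n powr \<omega>\<close> plus
  \<open>n * m\<close>, and no relation between \<open>\<omega>\<close> and 2 is at hand, so
  \<open>n * n\<close> steps for clearing a matrix could exceed it. Hence the reliance on memory
  that is 0 at the start: the matrix costs one store per arc, and every pair works on cells never
  touched before instead of clearing those of its predecessor. The price is that addresses grow like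
  \<open>n * n + n * k + m\<close>; as the run must stay free of overflow, a quadratic word bound
  has to be carried through every step. Much of the correctness argument is therefore about frames:
  which cells are still 0, and that no later write reaches the input, the matrix or an earlier
  answer. Time, overflow and correctness are proved together, in one calculus whose postconditions
  see the number of steps.\<close>

definition common_ancestor :: "('a, 'b) pre_digraph \<Rightarrow> 'a \<Rightarrow> 'a \<Rightarrow> 'a \<Rightarrow> bool" where
  "common_ancestor G u v s \<longleftrightarrow> s \<rightarrow>\<^sup>*\<^bsub>G\<^esub> u \<and> s \<rightarrow>\<^sup>*\<^bsub>G\<^esub> v"

context wf_digraph
begin

lemma directed_path_imp_reachable:
  assumes "directed_path G x p y"
  shows "x \<rightarrow>\<^sup>* y"
  using assms reachable_vpath_conv unfolding directed_path_def by blast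

lemma reachable_iff_directed_path: "x \<rightarrow>\<^sup>* y \<longleftrightarrow> (\<exists>p. directed_path G x p y)"
  unfolding directed_path_def reachable_vpath_conv by blast

text \<open>Cutting at \<open>w\<close> yields two walks that share it. This turns a vertex common
  to two paths into a common ancestor below their start.\<close>

lemma directed_path_through:
  assumes "directed_path G x p y" "w \<in> set p"
  shows "x \<rightarrow>\<^sup>* w" "w \<rightarrow>\<^sup>* y"
proof -
  obtain as bs where p: "p = as @ w # bs"
    using assms(2) by (meson split_list)
  have "vwalk p G" and ends: "hd p = x" "last p = y"
    using assms(1) by (auto simp: directed_path_def)
  then have "vwalk (as @ [w]) G" "vwalk (w # bs) G"
    unfolding p using vwalkI_append_l[of "as @ [w]" bs G] vwalkI_append_r[of "w # bs" as G] by auto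
  moreover have "hd (as @ [w]) = x" "last (w # bs) = y"
    using ends unfolding p by (auto simp: hd_append)
  ultimately show "x \<rightarrow>\<^sup>* w" "w \<rightarrow>\<^sup>* y"
    unfolding reachable_vwalk_conv by (metis last_snoc, metis list.sel(1))
qed

lemma junction_imp_common_ancestor: "junction G u v s \<Longrightarrow> common_ancestor G u v s"
  unfolding junction_def common_ancestor_def by (meson directed_path_imp_reachable)

text \<open>No special choice of paths is involved: a vertex shared by arbitrary paths from
  \<open>s\<close> to \<open>u\<close> and to \<open>v\<close> is a common ancestor reachable from
  \<open>s\<close>, so \<open>low\<close> identifies it with \<open>s\<close>.\<close>

lemma lowest_common_ancestor_imp_junction:
  assumes "u \<noteq> v" and s: "common_ancestor G u v s"
    and low: "\<And>w. common_ancestor G u v w \<Longrightarrow> s \<rightarrow>\<^sup>* w \<Longrightarrow> w = s"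
  shows "junction G u v s"
proof -
  obtain P Q where P: "directed_path G s P u" and Q: "directed_path G s Q v"
    using s unfolding common_ancestor_def reachable_iff_directed_path by blast
  have "w = s" if "w \<in> set P \<inter> set Q" for w
    using low[of w] that directed_path_through[OF P] directed_path_through[OF Q]
    by (auto simp: common_ancestor_def)
  moreover have "s \<in> set P \<inter> set Q"
    using P Q hd_in_set by (fastforce simp: directed_path_def vpath_def vwalk_def)
  ultimately have "set P \<inter> set Q = {s}"
    by blast
  then show ?thesis
    using assms(1) P Q unfolding junction_def by blast
qed

end

text \<open>Testing the out-neighbours is enough because a path from \<open>s\<close> to a lower
  common ancestor starts with an arc whose head still reaches that ancestor, hence \<open>u\<close>
  and \<open>v\<close>. This local condition is what the program evaluates.\<close>

lemma lca_iff_common_ancestor: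
  assumes "dag G"
  shows "lca G u v s \<longleftrightarrow>
    u \<noteq> v \<and> common_ancestor G u v s \<and> (\<forall>y. s \<rightarrow>\<^bsub>G\<^esub> y \<longrightarrow> \<not> common_ancestor G u v y)"
proof -
  interpret digraph G using assms by (simp add: dag_def)
  have acyc: "acyclic (arcs_ends G)" using assms by (simp add: dag_def)
  then have "wf ((arcs_ends G)\<inverse>)"
    by (simp add: arcs_ends_def finite_acyclic_wf_converse)
  \<comment> \<open>The transitive closure lets the induction below descend along a whole path at
    once.\<close>
  then have wf: "wf (((arcs_ends G)\<inverse>)\<^sup>+)"
    by (rule wf_trancl)
  have below: "(y, x) \<in> ((arcs_ends G)\<inverse>)\<^sup>+" if "x \<rightarrow>\<^sup>*\<^bsub>G\<^esub> y" "x \<noteq> y" for x y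
    using that reachable_neq_reachable1 by (metis trancl_converse converseI)
  have antisym: "x = y" if "x \<rightarrow>\<^sup>*\<^bsub>G\<^esub> y" "y \<rightarrow>\<^sup>*\<^bsub>G\<^esub> x" for x y
    using that below wf by (metis wf_asym)
  \<comment> \<open>Go down to a strictly lower common ancestor as long as there is one;
    well-foundedness ends the descent, at a vertex that is a junction.\<close>
  have lowest: "\<exists>c'. junction G u v c' \<and> c \<rightarrow>\<^sup>*\<^bsub>G\<^esub> c'" if "u \<noteq> v" "common_ancestor G u v c" for c
    using that(2)
  proof (induction c rule: wf_induct_rule[OF wf])
    case (1 c)
    show ?case
    proof (cases "\<exists>w. common_ancestor G u v w \<and> c \<rightarrow>\<^sup>*\<^bsub>G\<^esub> w \<and> w \<noteq> c")
      case True
      then obtain w where w: "common_ancestor G u v w" "c \<rightarrow>\<^sup>*\<^bsub>G\<^esub> w" "w \<noteq> c"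
        by blast
      then show ?thesis
        using 1(1)[OF below[OF w(2)] w(1)] reachable_trans[OF w(2)] by blast
    next
      case False
      then have "junction G u v c"
        using lowest_common_ancestor_imp_junction[OF that(1) 1(2)] by blast
      then show ?thesis
        using 1(2) reachable_in_verts by (auto simp: common_ancestor_def)
    qed
  qed
  show ?thesis
  proof
    assume L: "lca G u v s"
    then have J: "junction G u v s" and ne: "u \<noteq> v"
      by (auto simp: lca_def junction_def)
    \<comment> \<open>\<open>lca\<close> compares \<open>s\<close> with junctions only, so the
      common ancestor \<open>y\<close> is first followed down to a junction \<open>c\<close>. Were
      \<open>c = s\<close>, the arc from \<open>s\<close> to \<open>y\<close> would close a
      cycle.\<close>
    have False if sy: "s \<rightarrow>\<^bsub>G\<^esub> y" and y: "common_ancestor G u v y" for y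
    proof -
      obtain c where c: "junction G u v c" "y \<rightarrow>\<^sup>*\<^bsub>G\<^esub> c"
        using lowest[OF ne y] by blast
      then have "s \<rightarrow>\<^sup>*\<^bsub>G\<^esub> c" using sy adj_reachable_trans by blast
      moreover have "c \<noteq> s"
        using c(2) sy antisym[of y s] adj_not_same by blast
      ultimately show False
        using L c(1) unfolding lca_def reachable_iff_directed_path by blast
    qed
    then show "u \<noteq> v \<and> common_ancestor G u v s \<and> (\<forall>y. s \<rightarrow>\<^bsub>G\<^esub> y \<longrightarrow> \<not> common_ancestor G u v y)"
      using ne J junction_imp_common_ancestor by blast
  next
    assume R: "u \<noteq> v \<and> common_ancestor G u v s \<and> (\<forall>y. s \<rightarrow>\<^bsub>G\<^esub> y \<longrightarrow> \<not> common_ancestor G u v y)"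
    have low: "w = s" if w: "common_ancestor G u v w" and sw: "s \<rightarrow>\<^sup>*\<^bsub>G\<^esub> w" for w
    proof (rule ccontr)
      assume "w \<noteq> s"
      then obtain y where y: "s \<rightarrow>\<^bsub>G\<^esub> y" "y \<rightarrow>\<^sup>*\<^bsub>G\<^esub> w"
        using sw converse_reachable_cases by metis
      then have "common_ancestor G u v y"
        using w by (auto simp: common_ancestor_def intro: reachable_trans)
      then show False using R y(1) by blast
    qed
    then have "junction G u v s"
      using R lowest_common_ancestor_imp_junction by blast
    then show "lca G u v s"
      using low junction_imp_common_ancestor
      unfolding lca_def by (meson directed_path_imp_reachable)
  qed
qed

section \<open>Timed weakest preconditions\<close>

text \<open>Existence of a run matches the existential in \<open>solvable_in_time\<close>. As
  \<open>exec\<close> has no derivation for overflow or divergence, one such statement covers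
  termination, word size, running time and result.\<close>

definition wp :: "nat \<Rightarrow> com \<Rightarrow> (nat \<Rightarrow> state \<Rightarrow> bool) \<Rightarrow> state \<Rightarrow> bool" where
  "wp W c Q \<sigma> \<longleftrightarrow> (\<exists>t \<tau>. exec W c \<sigma> t \<tau> \<and> Q t \<tau>)"

inductive_cases exec_SkipE: "exec W Skip \<sigma> t \<tau>"
inductive_cases exec_AssignE: "exec W (Assign i e) \<sigma> t \<tau>"
inductive_cases exec_StoreE: "exec W (Store a e) \<sigma> t \<tau>"
inductive_cases exec_SeqE: "exec W (Seq c d) \<sigma> t \<tau>"
inductive_cases exec_IfE: "exec W (If e c d) \<sigma> t \<tau>"

text \<open>The rules from here to \<open>wp_If\<close> are equivalences for the simplifier, which
  thus executes loop-free code symbolically, adding up the costs and collecting the conditions on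
  word size.\<close>

lemma wp_Skip [simp]: "wp W Skip Q \<sigma> \<longleftrightarrow> Q 1 \<sigma>"
  unfolding wp_def by (metis exec.Skip exec_SkipE)

lemma wp_Assign [simp]: "wp W (Assign i e) Q \<sigma> \<longleftrightarrow>
    exp_fits W e \<sigma> \<and> Q (exp_cost e + 1) (\<sigma>\<lparr>reg := (reg \<sigma>)(i := exp_val e \<sigma>)\<rparr>)"
  unfolding wp_def by (metis exec.Assign exec_AssignE)

lemma wp_Store [simp]: "wp W (Store a e) Q \<sigma> \<longleftrightarrow>
    exp_fits W a \<sigma> \<and> exp_fits W e \<sigma> \<and>
    Q (exp_cost a + exp_cost e + 1) (\<sigma>\<lparr>mem := (mem \<sigma>)(exp_val a \<sigma> := exp_val e \<sigma>)\<rparr>)"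
  unfolding wp_def by (metis exec.Store exec_StoreE)

lemma wp_Seq [simp]:
  "wp W (Seq c d) Q \<sigma> \<longleftrightarrow> wp W c (\<lambda>t. wp W d (\<lambda>t'. Q (t + t'))) \<sigma>"
  unfolding wp_def by (fastforce elim!: exec_SeqE intro: exec.Seq)

lemma wp_If [simp]: "wp W (If e c d) Q \<sigma> \<longleftrightarrow>
    exp_fits W e \<sigma> \<and> wp W (if exp_val e \<sigma> \<noteq> 0 then c else d) (\<lambda>t. Q (exp_cost e + 1 + t)) \<sigma>"
  proof (cases "exp_val e \<sigma> = 0")
  case True
  then have "exec W (If e c d) \<sigma> t \<tau> \<longleftrightarrow>
      exp_fits W e \<sigma> \<and> (\<exists>r. t = exp_cost e + 1 + r \<and> exec W d \<sigma> r \<tau>)" for t \<tau>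
    by (auto elim!: exec_IfE intro: exec.IfFalse[simplified])
  then show ?thesis using True unfolding wp_def by auto
next
  case False
  then have "exec W (If e c d) \<sigma> t \<tau> \<longleftrightarrow>
      exp_fits W e \<sigma> \<and> (\<exists>r. t = exp_cost e + 1 + r \<and> exec W c \<sigma> r \<tau>)" for t \<tau>
    by (auto elim!: exec_IfE intro: exec.IfTrue[simplified])
  then show ?thesis using False unfolding wp_def by auto
qed

lemma wp_mono:
  assumes "wp W c Q \<sigma>" "\<And>t \<tau>. Q t \<tau> \<Longrightarrow> Q' t \<tau>"
  shows "wp W c Q' \<sigma>"
  using assms unfolding wp_def by blast

text \<open>\<open>f\<close> bounds the number of remaining iterations since it drops by at least
  one each time, and \<open>K\<close> bounds each run of the body. Every iteration pays for its
  test; the last summands are the failing test at the end.\<close>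

lemma wp_While:
  assumes "I \<sigma>"
    and fits: "\<And>\<sigma>. I \<sigma> \<Longrightarrow> exp_fits W e \<sigma>"
    and body: "\<And>\<sigma>. I \<sigma> \<Longrightarrow> exp_val e \<sigma> \<noteq> 0 \<Longrightarrow>
      wp W c (\<lambda>t \<tau>. t \<le> K \<and> I \<tau> \<and> f \<tau> < f \<sigma>) \<sigma>"
  shows "wp W (While e c)
    (\<lambda>t \<tau>. t \<le> f \<sigma> * (K + exp_cost e + 1) + exp_cost e + 1 \<and> I \<tau> \<and> exp_val e \<tau> = 0) \<sigma>"
  using assms(1)
proof (induction "f \<sigma>" arbitrary: \<sigma> rule: less_induct)
  case less
  show ?case
  proof (cases "exp_val e \<sigma> = 0")
    case True
    then show ?thesis
      using exec.WhileFalse[OF fits[OF less.prems] True] less.prems unfolding wp_def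
      by fastforce
  next
    case False
    then obtain t \<sigma>' where step: "exec W c \<sigma> t \<sigma>'" "t \<le> K" "I \<sigma>'" "f \<sigma>' < f \<sigma>"
      using body[OF less.prems] unfolding wp_def by blast
    obtain t' \<tau> where rest: "exec W (While e c) \<sigma>' t' \<tau>"
        "t' \<le> f \<sigma>' * (K + exp_cost e + 1) + exp_cost e + 1" "I \<tau>" "exp_val e \<tau> = 0"
      using less.hyps[OF step(4) step(3)] unfolding wp_def by blast
    have "Suc (f \<sigma>') * (K + exp_cost e + 1) \<le> f \<sigma> * (K + exp_cost e + 1)"
      using step(4) by (intro mult_right_mono) auto
    then have "exp_cost e + 1 + t + t' \<le> f \<sigma> * (K + exp_cost e + 1) + exp_cost e + 1"
      using step(2) rest(2) unfolding mult_Suc by linarith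
    then show ?thesis
      using exec.WhileTrue[OF fits[OF less.prems] False step(1) rest(1)] rest(3,4)
      unfolding wp_def by blast
  qed
qed

text \<open>Every loop of the program has a guard of this shape. \<open>1 \<le> W\<close> is there
  because the truth value of the comparison must fit into a word as well.\<close>

lemma wp_While_less:
  assumes "I \<sigma>"
    and fits: "\<And>\<tau>. I \<tau> \<Longrightarrow> exp_fits W a \<tau> \<and> exp_fits W b \<tau>" "1 \<le> W"
    and body: "\<And>\<tau>. I \<tau> \<Longrightarrow> exp_val a \<tau> < exp_val b \<tau> \<Longrightarrow>
      wp W c (\<lambda>t \<tau>'. t \<le> K \<and> I \<tau>' \<and> f \<tau>' < f \<tau>) \<tau>"
    and post: "\<And>t \<tau>. t \<le> f \<sigma> * (K + exp_cost a + exp_cost b + 2) + exp_cost a + exp_cost b + 2 \<Longrightarrow>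
      I \<tau> \<Longrightarrow> exp_val b \<tau> \<le> exp_val a \<tau> \<Longrightarrow> Q t \<tau>"
  shows "wp W (While (Bin Less a b) c) Q \<sigma>"
proof (rule wp_mono[OF wp_While[where I = I and f = f and K = K]])
  show "exp_fits W (Bin Less a b) \<tau>" if "I \<tau>" for \<tau>
    using fits(1)[OF that] fits(2) by (auto simp: of_bool_def)
  show "wp W c (\<lambda>t \<tau>'. t \<le> K \<and> I \<tau>' \<and> f \<tau>' < f \<tau>) \<tau>"
    if "I \<tau>" "exp_val (Bin Less a b) \<tau> \<noteq> 0" for \<tau>
    using body[OF that(1)] that(2) by (auto split: if_splits)
  show "Q t \<tau>"
    if "t \<le> f \<sigma> * (K + exp_cost (Bin Less a b) + 1) + exp_cost (Bin Less a b) + 1 \<and>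
      I \<tau> \<and> exp_val (Bin Less a b) \<tau> = 0" for t \<tau>
    using that by (intro post) (auto simp: add.assoc)
qed (rule assms(1))


section \<open>The program\<close>

abbreviation (input) add :: "exp \<Rightarrow> exp \<Rightarrow> exp" (infixl "\<^bold>+" 65) where "a \<^bold>+ b \<equiv> Bin Add a b"
abbreviation (input) mul :: "exp \<Rightarrow> exp \<Rightarrow> exp" (infixl "\<^bold>*" 70) where "a \<^bold>* b \<equiv> Bin Mul a b"
abbreviation (input) seq :: "com \<Rightarrow> com \<Rightarrow> com" (infixr ";;" 60) where "c ;; d \<equiv> Seq c d"

text \<open>
  Registers 0 to 3 hold \<open>n\<close>, \<open>m\<close>, \<open>k\<close> and the address of the matrix whose entry
  \<open>(x, y)\<close> tells whether \<open>(y, x)\<close> is an arc, registers 4 to 9 belong to the loop over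
  the pairs, and all others are scratch. Each pair is given \<open>5 * n + 1\<close> fresh cells from the
  address in register 6 on: marks and a queue for either vertex, then the answer. Memory that has
  not been used is 0, so nothing needs to be cleared.
\<close>

definition build_matrix :: com where
  "build_matrix =
    Assign 3 (Reg 1 \<^bold>+ Reg 2 \<^bold>+ (Reg 1 \<^bold>+ Reg 2)) ;;
    Assign 10 (Const 0) ;;
    While (Bin Less (Reg 10) (Reg 1 \<^bold>+ Reg 1))
     (Store (Reg 3 \<^bold>+ (Reg 0 \<^bold>* Load (Reg 10 \<^bold>+ Const 1) \<^bold>+ Load (Reg 10))) (Const 1) ;;
      Assign 10 (Reg 10 \<^bold>+ Const 2))"

text \<open>With entries 0 and 1, a mark smaller than a matrix entry means unmarked and adjacent:
  \<open>Less\<close> stands for a conjunction with a negation.\<close>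

definition scan_predecessors :: com where
  "scan_predecessors =
    While (Bin Less (Reg 15) (Reg 0))
     (If (Bin Less (Load (Reg 10 \<^bold>+ Reg 15)) (Load (Reg 3 \<^bold>+ (Reg 0 \<^bold>* Reg 14 \<^bold>+ Reg 15))))
       (Store (Reg 10 \<^bold>+ Reg 15) (Const 1) ;;
        Store (Reg 13) (Reg 15) ;;
        Assign 13 (Reg 13 \<^bold>+ Const 1))
       Skip ;;
      Assign 15 (Reg 15 \<^bold>+ Const 1))"

text \<open>
  Register 11 holds the vertex whose ancestors are sought and register 10 the address of
  \<open>n\<close> marks, followed by a queue between the addresses in registers 12 and 13.
\<close>

definition mark_ancestors :: com where
  "mark_ancestors =
    Store (Reg 10 \<^bold>+ Reg 11) (Const 1) ;;
    Assign 12 (Reg 10 \<^bold>+ Reg 0) ;;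
    Store (Reg 12) (Reg 11) ;;
    Assign 13 (Reg 12 \<^bold>+ Const 1) ;;
    While (Bin Less (Reg 12) (Reg 13))
     (Assign 14 (Load (Reg 12)) ;;
      Assign 12 (Reg 12 \<^bold>+ Const 1) ;;
      Assign 15 (Const 0) ;;
      scan_predecessors)"

text \<open>Register 11 is a flag: comparing the product of three bits with it leaves 1 only if the
  flag was 1 and the product is 0, so a single common ancestor among the out-neighbours clears it
  for good.\<close>

definition test_lowest :: com where
  "test_lowest =
    While (Bin Less (Reg 12) (Reg 0))
     (Assign 11 (Bin Less
        (Load (Reg 3 \<^bold>+ (Reg 0 \<^bold>* Reg 12 \<^bold>+ Reg 10)) \<^bold>*
          (Load (Reg 6 \<^bold>+ Reg 12) \<^bold>* Load (Reg 6 \<^bold>+ (Reg 0 \<^bold>+ Reg 0 \<^bold>+ Reg 12))))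
        (Reg 11)) ;;
      Assign 12 (Reg 12 \<^bold>+ Const 1))"

text \<open>The count in the first cell is raised before the vertex is stored, so that the new count
  is also the offset of the next free cell.\<close>

definition collect_lowest :: com where
  "collect_lowest =
    Assign 10 (Const 0) ;;
    While (Bin Less (Reg 10) (Reg 0))
     (Assign 11 (Load (Reg 6 \<^bold>+ Reg 10) \<^bold>* Load (Reg 6 \<^bold>+ (Reg 0 \<^bold>+ Reg 0 \<^bold>+ Reg 10))) ;;
      Assign 12 (Const 0) ;;
      test_lowest ;;
      If (Reg 11)
       (Store (Reg 9) (Load (Reg 9) \<^bold>+ Const 1) ;;
        Store (Reg 9 \<^bold>+ Load (Reg 9)) (Reg 10))
       Skip ;;
      Assign 10 (Reg 10 \<^bold>+ Const 1))"

text \<open>The area of a pair consists of \<open>n\<close> marks and \<open>n\<close> queue cells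
  for each vertex and of \<open>n + 1\<close> cells for the length and the entries of the answer.
  For equal vertices the length cell is never written; its initial 0 already encodes the empty list.
  In an acyclic graph the searches would instead produce the vertex itself.\<close>

definition answer_pair :: com where
  "answer_pair =
    Assign 7 (Load (Reg 1 \<^bold>+ Reg 1 \<^bold>+ (Reg 5 \<^bold>+ Reg 5))) ;;
    Assign 8 (Load (Reg 1 \<^bold>+ Reg 1 \<^bold>+ (Reg 5 \<^bold>+ Reg 5) \<^bold>+ Const 1)) ;;
    Assign 9 (Reg 6 \<^bold>+ (Reg 0 \<^bold>+ Reg 0 \<^bold>+ Reg 0 \<^bold>+ Reg 0)) ;;
    Store (Reg 4 \<^bold>+ Reg 5) (Reg 9) ;;
    If (Bin Equal (Reg 7) (Reg 8)) Skip
     (Assign 10 (Reg 6) ;; Assign 11 (Reg 7) ;; mark_ancestors ;;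
      Assign 10 (Reg 6 \<^bold>+ (Reg 0 \<^bold>+ Reg 0)) ;; Assign 11 (Reg 8) ;; mark_ancestors ;;
      collect_lowest) ;;
    Assign 6 (Reg 9 \<^bold>+ Reg 0 \<^bold>+ Const 1) ;;
    Assign 5 (Reg 5 \<^bold>+ Const 1)"

text \<open>Input, matrix, pointer table and areas follow each other in memory. Register 0 holds
  \<open>n\<close> until the very end, where the address of the table replaces it.\<close>

definition lca_program :: com where
  "lca_program =
    build_matrix ;;
    Assign 4 (Reg 3 \<^bold>+ Reg 0 \<^bold>* Reg 0) ;;
    Assign 5 (Const 0) ;;
    Assign 6 (Reg 4 \<^bold>+ Reg 2) ;;
    While (Bin Less (Reg 5) (Reg 2)) answer_pair ;;
    Assign 0 (Reg 4)"

section \<open>Correctness and running time\<close>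

lemma matrix_index_less: "x < n \<Longrightarrow> y < n \<Longrightarrow> n * x + y < n * n" for n x y :: nat
  by (metis add.commute add_less_cancel_left less_le_trans mult.commute mult_Suc mult_le_mono1 Suc_leI)

definition has_matrix :: "nat \<Rightarrow> (nat \<times> nat) set \<Rightarrow> nat \<Rightarrow> (nat \<Rightarrow> nat) \<Rightarrow> bool" where
  "has_matrix n E A M \<longleftrightarrow> (\<forall>x<n. \<forall>y<n. M (A + (n * x + y)) = of_bool ((y, x) \<in> E))"

lemma has_matrixD:
  "has_matrix n E A M \<Longrightarrow> x < n \<Longrightarrow> y < n \<Longrightarrow> M (A + (n * x + y)) = of_bool ((y, x) \<in> E)"
  by (simp add: has_matrix_def)

lemma has_matrix_cong:
  assumes "has_matrix n E A M" "\<And>a. a < A + n * n \<Longrightarrow> M' a = M a"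
  shows "has_matrix n E A M'"
  using assms matrix_index_less unfolding has_matrix_def by simp

text \<open>\<open>q\<close> is the full history of the queue, dequeued vertices included. So the
  marks are exactly its members, it has no repetitions, and \<open>n\<close> cells suffice without
  wrapping around. The head of the queue, register 12, is left out because the main loop moves it
  between scans.\<close>

definition queue_state ::
  "nat \<Rightarrow> nat \<Rightarrow> state \<Rightarrow> nat list \<Rightarrow> state \<Rightarrow> bool" where
  "queue_state n B \<sigma>\<^sub>0 q \<sigma> \<longleftrightarrow>
    distinct q \<and> set q \<subseteq> {..<n} \<and>
    (\<forall>r<12. reg \<sigma> r = reg \<sigma>\<^sub>0 r) \<and> reg \<sigma> 13 = B + n + length q \<and>
    (\<forall>x<n. mem \<sigma> (B + x) = of_bool (x \<in> set q)) \<and>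
    (\<forall>j<length q. mem \<sigma> (B + n + j) = q ! j) \<and>
    (\<forall>a<B. mem \<sigma> a = mem \<sigma>\<^sub>0 a) \<and> (\<forall>a\<ge>B + 2 * n. mem \<sigma> a = 0)"

lemma distinct_length_le: "distinct q \<Longrightarrow> set q \<subseteq> {..<n} \<Longrightarrow> length q \<le> n" for q :: "nat list"
  by (metis card_lessThan card_mono distinct_card finite_lessThan)

lemma queue_state_push:
  assumes "queue_state n B \<sigma>\<^sub>0 q \<sigma>" "y < n" "y \<notin> set q"
    "\<And>r. r < 12 \<Longrightarrow> reg \<sigma>' r = reg \<sigma> r" "reg \<sigma>' 13 = reg \<sigma> 13 + 1"
    "mem \<sigma>' = (mem \<sigma>)(B + y := 1, B + n + length q := y)"
  shows "queue_state n B \<sigma>\<^sub>0 (q @ [y]) \<sigma>'"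
proof -
  have "length (q @ [y]) \<le> n"
    using assms(1-3) by (intro distinct_length_le) (auto simp: queue_state_def)
  then show ?thesis
    using assms unfolding queue_state_def by (auto simp: nth_append less_Suc_eq)
qed

section \<open>Backward search for the ancestors of a vertex\<close>

locale memory_layout =
  fixes W n A :: nat and E :: "(nat \<times> nat) set"
  assumes n_pos: "0 < n" and E_subset: "E \<subseteq> {..<n} \<times> {..<n}"
begin

text \<open>One scan only appends to the history: \<open>q'\<close> are the newly found
  predecessors. Membership in \<open>E\<^sup>*\<close> keeps the marks sound, the last clause makes
  the search complete at \<open>x\<close>.\<close>

lemma wp_scan_predecessors:
  assumes q: "queue_state n B \<sigma>\<^sub>0 q \<sigma>"
    and regs: "reg \<sigma> 0 = n" "reg \<sigma> 3 = A" "reg \<sigma> 10 = B"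
    and x: "reg \<sigma> 14 = x" "x < n" and y: "reg \<sigma> 15 = 0"
    and anc: "\<forall>z\<in>set q. (z, s) \<in> E\<^sup>*" "(x, s) \<in> E\<^sup>*"
    and M: "has_matrix n E A (mem \<sigma>\<^sub>0)"
    and bounds: "A + n * n \<le> B" "B + 2 * n < W"
  shows "wp W scan_predecessors (\<lambda>t \<tau>. t \<le> 40 * n + 10 \<and> reg \<tau> 12 = reg \<sigma> 12 \<and>
    (\<exists>q'. queue_state n B \<sigma>\<^sub>0 (q @ q') \<tau> \<and> (\<forall>z\<in>set (q @ q'). (z, s) \<in> E\<^sup>*) \<and>
       (\<forall>z. (z, x) \<in> E \<longrightarrow> z \<in> set (q @ q')))) \<sigma>"
proof -
  define I where "I \<tau> \<longleftrightarrow> reg \<tau> 15 \<le> n \<and> reg \<tau> 14 = x \<and> reg \<tau> 12 = reg \<sigma> 12 \<and>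
    (\<exists>q'. queue_state n B \<sigma>\<^sub>0 (q @ q') \<tau> \<and> (\<forall>z\<in>set (q @ q'). (z, s) \<in> E\<^sup>*) \<and>
       (\<forall>z<reg \<tau> 15. (z, x) \<in> E \<longrightarrow> z \<in> set (q @ q')))" for \<tau>
  have regs0: "reg \<sigma>\<^sub>0 0 = n" "reg \<sigma>\<^sub>0 3 = A" "reg \<sigma>\<^sub>0 10 = B"
    using q regs by (auto simp: queue_state_def)
  show ?thesis
    unfolding scan_predecessors_def
  proof (rule wp_While_less[where I = I and f = "\<lambda>\<tau>. n - reg \<tau> 15" and K = 36])
    show "I \<sigma>" using q anc x y unfolding I_def by (auto intro!: exI[of _ "[]"])
  next
    fix \<tau> assume "I \<tau>"
    then show "exp_fits W (Reg 15) \<tau> \<and> exp_fits W (Reg 0) \<tau>"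
      using bounds regs0 by (auto simp: I_def queue_state_def)
  next
    fix \<tau> assume I: "I \<tau>" and "exp_val (Reg 15) \<tau> < exp_val (Reg 0) \<tau>"
    then have guard: "reg \<tau> 15 < n"
      using regs0 by (auto simp: I_def queue_state_def)
    obtain q' where q': "queue_state n B \<sigma>\<^sub>0 (q @ q') \<tau>" "\<forall>z\<in>set (q @ q'). (z, s) \<in> E\<^sup>*"
       "\<forall>z<reg \<tau> 15. (z, x) \<in> E \<longrightarrow> z \<in> set (q @ q')"
      using I unfolding I_def by blast
    define y where "y = reg \<tau> 15"
    have y: "y < n" "reg \<tau> 15 = y" using guard by (auto simp: y_def)
    have x': "reg \<tau> 14 = x" using I by (simp add: I_def)
    have r: "reg \<tau> 0 = n" "reg \<tau> 3 = A" "reg \<tau> 10 = B" "reg \<tau> 13 = B + n + length (q @ q')"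
      using q'(1) regs0 by (auto simp: queue_state_def)
    have idx: "n * x + y < n * n" using matrix_index_less x(2) y(1) by blast
    have adj: "mem \<tau> (A + (n * x + y)) = of_bool ((y, x) \<in> E)"
      using has_matrixD[OF M x(2) y(1)] q'(1) idx bounds(1) by (auto simp: queue_state_def)
    have mark: "mem \<tau> (B + y) = of_bool (y \<in> set (q @ q'))"
      using q'(1) y(1) by (auto simp: queue_state_def)
    have len: "length (q @ q') \<le> n"
      using q'(1) by (intro distinct_length_le) (auto simp: queue_state_def)
    show "wp W
     (If (Bin Less (Load (Reg 10 \<^bold>+ Reg 15)) (Load (Reg 3 \<^bold>+ (Reg 0 \<^bold>* Reg 14 \<^bold>+ Reg 15))))
       (Store (Reg 10 \<^bold>+ Reg 15) (Const 1) ;;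
        Store (Reg 13) (Reg 15) ;;
        Assign 13 (Reg 13 \<^bold>+ Const 1))
       Skip ;;
      Assign 15 (Reg 15 \<^bold>+ Const 1))
     (\<lambda>t \<tau>'. t \<le> 36 \<and> I \<tau>' \<and> n - reg \<tau>' 15 < n - reg \<tau> 15) \<tau>"
    proof (cases "y \<notin> set (q @ q') \<and> (y, x) \<in> E")
      case True
      define \<tau>' where "\<tau>' = \<tau>\<lparr>mem := (mem \<tau>)(B + y := 1, B + n + length (q @ q') := y),
        reg := (reg \<tau>)(13 := B + n + length (q @ q') + 1, 15 := y + 1)\<rparr>"
      \<comment> \<open>The extended history still has distinct entries below \<open>n\<close>, so
        before the push there was a free cell; this keeps the write inside the queue and its address
        below \<open>W\<close>.\<close>
      have "length (q @ q' @ [y]) \<le> n"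
        using q'(1) True y by (intro distinct_length_le) (auto simp: queue_state_def)
      then have len': "length (q @ q') < n" by simp
      have "queue_state n B \<sigma>\<^sub>0 ((q @ q') @ [y]) \<tau>'"
        using True y by (intro queue_state_push[OF q'(1)]) (auto simp: \<tau>'_def r)
      moreover have "(y, s) \<in> E\<^sup>*"
        using True anc(2) by (meson converse_rtrancl_into_rtrancl)
      ultimately have "I \<tau>'"
        using q' y x' I unfolding I_def
        by (auto simp: \<tau>'_def less_Suc_eq intro!: exI[of _ "q' @ [y]"])
      then show ?thesis
        using True len' len idx bounds r x' x(2) y adj mark
        by (simp add: \<tau>'_def fun_upd_def diff_less_mono2)
    next
      case False
      have "I (\<tau>\<lparr>reg := (reg \<tau>)(15 := y + 1)\<rparr>)"
        using False q' y x' I unfolding I_def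
        by (auto simp: less_Suc_eq queue_state_def intro!: exI[of _ q'])
      then show ?thesis
        using False len idx bounds r x' x(2) y adj mark by auto
    qed
  next
    fix t \<tau>
    assume "I \<tau>" and ge: "exp_val (Reg 0) \<tau> \<le> exp_val (Reg 15) \<tau>"
      and t: "t \<le> (n - reg \<sigma> 15) * (36 + exp_cost (Reg 15) + exp_cost (Reg 0) + 2)
        + exp_cost (Reg 15) + exp_cost (Reg 0) + 2"
    then obtain q' where q': "queue_state n B \<sigma>\<^sub>0 (q @ q') \<tau>" "\<forall>z\<in>set (q @ q'). (z, s) \<in> E\<^sup>*"
       "\<forall>z<reg \<tau> 15. (z, x) \<in> E \<longrightarrow> z \<in> set (q @ q')" "reg \<tau> 12 = reg \<sigma> 12"
      unfolding I_def by blast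
    have "n \<le> reg \<tau> 15"
      using ge q'(1) regs0 by (auto simp: queue_state_def)
    then have "\<forall>z. (z, x) \<in> E \<longrightarrow> z \<in> set (q @ q')"
      using q'(3) E_subset by fastforce
    then show "t \<le> 40 * n + 10 \<and> reg \<tau> 12 = reg \<sigma> 12 \<and>
    (\<exists>q'. queue_state n B \<sigma>\<^sub>0 (q @ q') \<tau> \<and> (\<forall>z\<in>set (q @ q'). (z, s) \<in> E\<^sup>*) \<and>
       (\<forall>z. (z, x) \<in> E \<longrightarrow> z \<in> set (q @ q')))"
      using q' t y by auto
  qed (use bounds in simp)
qed

text \<open>Each vertex is dequeued at most once and each scan is linear in \<open>n\<close>, hence
  the quadratic time. When the queue is empty, the marked set contains \<open>s\<close> and is
  closed under predecessors, so it contains all ancestors.\<close>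

lemma wp_mark_ancestors:
  assumes regs: "reg \<sigma> 0 = n" "reg \<sigma> 3 = A" "reg \<sigma> 10 = B" "reg \<sigma> 11 = s" and s: "s < n"
    and M: "has_matrix n E A (mem \<sigma>)" and fresh: "\<forall>a\<ge>B. mem \<sigma> a = 0"
    and bounds: "A + n * n \<le> B" "B + 2 * n < W"
  shows "wp W mark_ancestors (\<lambda>t \<tau>. t \<le> 150 * (n * n) \<and>
    (\<forall>r<12. reg \<tau> r = reg \<sigma> r) \<and> (\<forall>a<B. mem \<tau> a = mem \<sigma> a) \<and>
    (\<forall>a\<ge>B + 2 * n. mem \<tau> a = 0) \<and> (\<forall>x<n. mem \<tau> (B + x) = of_bool ((x, s) \<in> E\<^sup>*))) \<sigma>"
proof -
  \<comment> \<open>\<open>h\<close> counts the dequeued vertices; all predecessors of the first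
    \<open>h\<close> entries are already in the history.\<close>
  define I where "I \<tau> \<longleftrightarrow> (\<exists>q h. queue_state n B \<sigma> q \<tau> \<and> h \<le> length q \<and> reg \<tau> 12 = B + n + h \<and>
    s \<in> set q \<and> (\<forall>z\<in>set q. (z, s) \<in> E\<^sup>*) \<and> (\<forall>j<h. \<forall>z. (z, q ! j) \<in> E \<longrightarrow> z \<in> set q))" for \<tau>
  define \<sigma>\<^sub>1 where "\<sigma>\<^sub>1 = \<sigma>\<lparr>mem := (mem \<sigma>)(B + s := 1, B + n := s),
    reg := (reg \<sigma>)(12 := B + n, 13 := B + n + 1)\<rparr>"
  have "queue_state n B \<sigma> [s] \<sigma>\<^sub>1"
    using s regs fresh by (auto simp: queue_state_def \<sigma>\<^sub>1_def)
  then have init: "I \<sigma>\<^sub>1"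
    unfolding I_def by (intro exI[of _ "[s]"] exI[of _ 0]) (auto simp: \<sigma>\<^sub>1_def)
  \<comment> \<open>The 20 spare steps pay for the four statements before the loop.\<close>
  have "wp W (While (Bin Less (Reg 12) (Reg 13))
     (Assign 14 (Load (Reg 12)) ;; Assign 12 (Reg 12 \<^bold>+ Const 1) ;; Assign 15 (Const 0) ;;
      scan_predecessors))
    (\<lambda>t \<tau>. t + 20 \<le> 150 * (n * n) \<and>
    (\<forall>r<12. reg \<tau> r = reg \<sigma> r) \<and> (\<forall>a<B. mem \<tau> a = mem \<sigma> a) \<and>
    (\<forall>a\<ge>B + 2 * n. mem \<tau> a = 0) \<and> (\<forall>x<n. mem \<tau> (B + x) = of_bool ((x, s) \<in> E\<^sup>*))) \<sigma>\<^sub>1"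
  \<comment> \<open>Register 12 starts at \<open>B + n\<close> and never passes
    \<open>B + 2 * n\<close>, so this variant allows \<open>n\<close> iterations.\<close>
  proof (rule wp_While_less[where I = I and f = "\<lambda>\<tau>. B + 2 * n - reg \<tau> 12" and K = "40 * n + 30"])
    fix \<tau> assume "I \<tau>"
    then obtain q h where q: "queue_state n B \<sigma> q \<tau>" "h \<le> length q" "reg \<tau> 12 = B + n + h"
      unfolding I_def by blast
    have len: "length q \<le> n"
      using q(1) by (intro distinct_length_le) (auto simp: queue_state_def)
    then show "exp_fits W (Reg 12) \<tau> \<and> exp_fits W (Reg 13) \<tau>"
      using q bounds by (auto simp: queue_state_def)
  next
    fix \<tau> assume "I \<tau>" and "exp_val (Reg 12) \<tau> < exp_val (Reg 13) \<tau>"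
    then obtain q h where q: "queue_state n B \<sigma> q \<tau>" "h < length q" "reg \<tau> 12 = B + n + h"
      and qs: "s \<in> set q" "\<forall>z\<in>set q. (z, s) \<in> E\<^sup>*" "\<forall>j<h. \<forall>z. (z, q ! j) \<in> E \<longrightarrow> z \<in> set q"
      unfolding I_def by (auto simp: queue_state_def)
    have len: "length q \<le> n"
      using q(1) by (intro distinct_length_le) (auto simp: queue_state_def)
    define x where "x = q ! h"
    have x: "x \<in> set q" "x < n" "mem \<tau> (B + n + h) = x"
      using q(1,2) by (auto simp: x_def queue_state_def subset_iff)
    define \<tau>' where "\<tau>' = \<tau>\<lparr>reg := (reg \<tau>)(14 := x, 12 := B + n + h + 1, 15 := 0)\<rparr>"
    have q\<tau>': "queue_state n B \<sigma> q \<tau>'"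
      using q(1) by (auto simp: queue_state_def \<tau>'_def)
    have "wp W scan_predecessors (\<lambda>t \<tau>''. t \<le> 40 * n + 10 \<and> reg \<tau>'' 12 = reg \<tau>' 12 \<and>
      (\<exists>q'. queue_state n B \<sigma> (q @ q') \<tau>'' \<and> (\<forall>z\<in>set (q @ q'). (z, s) \<in> E\<^sup>*) \<and>
       (\<forall>z. (z, x) \<in> E \<longrightarrow> z \<in> set (q @ q')))) \<tau>'"
      using q\<tau>' regs x qs(2) M bounds
      by (intro wp_scan_predecessors) (auto simp: \<tau>'_def queue_state_def)
    then have "wp W scan_predecessors (\<lambda>t \<tau>''. t \<le> 40 * n + 10 \<and> I \<tau>'' \<and>
      reg \<tau>'' 12 = B + n + h + 1) \<tau>'"
    proof (rule wp_mono, elim conjE exE)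
      fix t \<tau>'' q'
      assume *: "t \<le> 40 * n + 10" "reg \<tau>'' 12 = reg \<tau>' 12" "queue_state n B \<sigma> (q @ q') \<tau>''"
        "\<forall>z\<in>set (q @ q'). (z, s) \<in> E\<^sup>*" "\<forall>z. (z, x) \<in> E \<longrightarrow> z \<in> set (q @ q')"
      have "I \<tau>''"
        unfolding I_def using * q(2) qs
        by (intro exI[of _ "q @ q'"] exI[of _ "h + 1"])
          (auto simp: \<tau>'_def nth_append less_Suc_eq x_def)
      then show "t \<le> 40 * n + 10 \<and> I \<tau>'' \<and> reg \<tau>'' 12 = B + n + h + 1"
        using * by (simp add: \<tau>'_def)
    qed
    then show "wp W (Assign 14 (Load (Reg 12)) ;; Assign 12 (Reg 12 \<^bold>+ Const 1) ;; Assign 15 (Const 0) ;;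
      scan_predecessors) (\<lambda>t \<tau>'. t \<le> 40 * n + 30 \<and> I \<tau>' \<and> B + 2 * n - reg \<tau>' 12 < B + 2 * n - reg \<tau> 12) \<tau>"
      using q len x bounds by (auto simp: \<tau>'_def fun_upd_def elim!: wp_mono)
  next
    fix t \<tau>
    assume "I \<tau>" and ge: "exp_val (Reg 13) \<tau> \<le> exp_val (Reg 12) \<tau>"
      and t: "t \<le> (B + 2 * n - reg \<sigma>\<^sub>1 12) * (40 * n + 30 + exp_cost (Reg 12) + exp_cost (Reg 13) + 2)
        + exp_cost (Reg 12) + exp_cost (Reg 13) + 2"
    then obtain q h where q: "queue_state n B \<sigma> q \<tau>" "h \<le> length q" "reg \<tau> 12 = B + n + h"
      and qs: "s \<in> set q" "\<forall>z\<in>set q. (z, s) \<in> E\<^sup>*" "\<forall>j<h. \<forall>z. (z, q ! j) \<in> E \<longrightarrow> z \<in> set q"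
      unfolding I_def by blast
    have "h = length q"
      using q ge by (auto simp: queue_state_def)
    have closed: "z \<in> set q" if "(z, x) \<in> E" "x \<in> set q" for x z
      using qs(3) that \<open>h = length q\<close> by (metis in_set_conv_nth)
    have "z \<in> set q" if "(z, s) \<in> E\<^sup>*" for z
      using that by (induction rule: converse_rtrancl_induct) (use qs(1) closed in auto)
    then have "z \<in> set q \<longleftrightarrow> (z, s) \<in> E\<^sup>*" for z
      using qs(2) by blast
    moreover have "t \<le> 34 * n + 40 * (n * n) + 4"
      using t by (simp add: \<sigma>\<^sub>1_def algebra_simps)
    moreover have "n \<le> n * n" "1 \<le> n * n" using n_pos by auto
    ultimately have "t + 20 \<le> 150 * (n * n)" "\<And>z. z \<in> set q \<longleftrightarrow> (z, s) \<in> E\<^sup>*"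
      by (linarith, blast)
    then show "t + 20 \<le> 150 * (n * n) \<and>
      (\<forall>r<12. reg \<tau> r = reg \<sigma> r) \<and> (\<forall>a<B. mem \<tau> a = mem \<sigma> a) \<and>
      (\<forall>a\<ge>B + 2 * n. mem \<tau> a = 0) \<and> (\<forall>x<n. mem \<tau> (B + x) = of_bool ((x, s) \<in> E\<^sup>*))"
      using q by (simp add: queue_state_def)
  qed (use bounds init in auto)
  then show ?thesis
    unfolding mark_ancestors_def using regs s bounds
    by (auto simp: \<sigma>\<^sub>1_def fun_upd_def elim!: wp_mono)
qed

end


section \<open>Selecting the lowest among the common ancestors\<close>

definition has_marks :: "nat \<Rightarrow> (nat \<Rightarrow> bool) \<Rightarrow> nat \<Rightarrow> (nat \<Rightarrow> nat) \<Rightarrow> bool" where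
  "has_marks n U B M \<longleftrightarrow> (\<forall>x<n. M (B + x) = of_bool (U x))"

text \<open>A filter of \<open>[0..<n]\<close> reproduces the order in which the program writes the
  vertices, so memory can be compared entry by entry, and distinctness is immediate.\<close>

definition lowest_members :: "nat \<Rightarrow> (nat \<times> nat) set \<Rightarrow> (nat \<Rightarrow> bool) \<Rightarrow> nat list" where
  "lowest_members n E U = filter (\<lambda>s. U s \<and> (\<forall>y<n. (s, y) \<in> E \<longrightarrow> \<not> U y)) [0..<n]"

context memory_layout
begin

text \<open>The second family of marks sits at distance \<open>2 * n\<close> from the first because
  the queue of the first search lies between them.\<close>

lemma wp_test_lowest:
  assumes regs: "reg \<sigma> 0 = n" "reg \<sigma> 3 = A" "reg \<sigma> 6 = P" "reg \<sigma> 10 = s" "reg \<sigma> 11 = of_bool b"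
      "reg \<sigma> 12 = 0" and s: "s < n"
    and M: "has_matrix n E A (mem \<sigma>)" "has_marks n U P (mem \<sigma>)" "has_marks n V (P + 2 * n) (mem \<sigma>)"
    and bounds: "A + n * n \<le> P" "P + 3 * n < W"
  shows "wp W test_lowest (\<lambda>t \<tau>. t \<le> 40 * n + 10 \<and> mem \<tau> = mem \<sigma> \<and>
    (\<forall>r. r \<noteq> 11 \<longrightarrow> r \<noteq> 12 \<longrightarrow> reg \<tau> r = reg \<sigma> r) \<and>
    reg \<tau> 11 = of_bool (b \<and> (\<forall>y<n. (s, y) \<in> E \<longrightarrow> \<not> (U y \<and> V y)))) \<sigma>"
  unfolding test_lowest_def
proof (rule wp_While_less[where f = "\<lambda>\<tau>. n - reg \<tau> 12" and K = 36 and
    I = "\<lambda>\<tau>. reg \<tau> 12 \<le> n \<and> mem \<tau> = mem \<sigma> \<and> (\<forall>r. r \<noteq> 11 \<longrightarrow> r \<noteq> 12 \<longrightarrow> reg \<tau> r = reg \<sigma> r) \<and>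
      reg \<tau> 11 = of_bool (b \<and> (\<forall>y<reg \<tau> 12. (s, y) \<in> E \<longrightarrow> \<not> (U y \<and> V y)))"])
  fix \<tau>
  assume I: "reg \<tau> 12 \<le> n \<and> mem \<tau> = mem \<sigma> \<and> (\<forall>r. r \<noteq> 11 \<longrightarrow> r \<noteq> 12 \<longrightarrow> reg \<tau> r = reg \<sigma> r) \<and>
      reg \<tau> 11 = of_bool (b \<and> (\<forall>y<reg \<tau> 12. (s, y) \<in> E \<longrightarrow> \<not> (U y \<and> V y)))"
    and "exp_val (Reg 12) \<tau> < exp_val (Reg 0) \<tau>"
  define y where "y = reg \<tau> 12"
  then have y: "y < n" "reg \<tau> 12 = y"
    using \<open>exp_val (Reg 12) \<tau> < exp_val (Reg 0) \<tau>\<close> I regs by auto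
  have r: "reg \<tau> 0 = n" "reg \<tau> 3 = A" "reg \<tau> 6 = P" "reg \<tau> 10 = s"
    using I regs by auto
  have m: "mem \<tau> (A + (n * y + s)) = of_bool ((s, y) \<in> E)" "mem \<tau> (P + y) = of_bool (U y)"
    "mem \<tau> (P + (2 * n + y)) = of_bool (V y)"
    using I has_matrixD[OF M(1) y(1) s] M(2,3) y(1) by (auto simp: has_marks_def add.assoc)
  have idx: "n * y + s < n * n" using matrix_index_less s y(1) by blast
  show "wp W (Assign 11 (Bin Less
        (Load (Reg 3 \<^bold>+ (Reg 0 \<^bold>* Reg 12 \<^bold>+ Reg 10)) \<^bold>*
          (Load (Reg 6 \<^bold>+ Reg 12) \<^bold>* Load (Reg 6 \<^bold>+ (Reg 0 \<^bold>+ Reg 0 \<^bold>+ Reg 12))))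
        (Reg 11)) ;;
      Assign 12 (Reg 12 \<^bold>+ Const 1))
     (\<lambda>t \<tau>'. t \<le> 36 \<and> (reg \<tau>' 12 \<le> n \<and> mem \<tau>' = mem \<sigma> \<and>
       (\<forall>r. r \<noteq> 11 \<longrightarrow> r \<noteq> 12 \<longrightarrow> reg \<tau>' r = reg \<sigma> r) \<and>
       reg \<tau>' 11 = of_bool (b \<and> (\<forall>y<reg \<tau>' 12. (s, y) \<in> E \<longrightarrow> \<not> (U y \<and> V y)))) \<and>
       n - reg \<tau>' 12 < n - reg \<tau> 12) \<tau>"
    using I r m y s idx bounds by (auto simp: less_Suc_eq mult_2[symmetric] of_bool_def)
qed (use regs bounds s in auto)

lemma wp_collect_lowest:
  assumes regs: "reg \<sigma> 0 = n" "reg \<sigma> 3 = A" "reg \<sigma> 6 = P" "reg \<sigma> 9 = L"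
    and M: "has_matrix n E A (mem \<sigma>)" "has_marks n U P (mem \<sigma>)" "has_marks n V (P + 2 * n) (mem \<sigma>)"
    and fresh: "\<forall>a\<ge>L. mem \<sigma> a = 0"
    and bounds: "A + n * n \<le> P" "P + 3 * n \<le> L" "L + n < W"
  shows "wp W collect_lowest (\<lambda>t \<tau>. t \<le> 200 * (n * n) \<and>
    (\<forall>r<10. reg \<tau> r = reg \<sigma> r) \<and> (\<forall>a<L. mem \<tau> a = mem \<sigma> a) \<and> (\<forall>a>L + n. mem \<tau> a = 0) \<and>
    stored_list \<tau> L = lowest_members n E (\<lambda>x. U x \<and> V x)) \<sigma>"
proof -
  define good where "good s \<longleftrightarrow> (U s \<and> V s) \<and> (\<forall>y<n. (s, y) \<in> E \<longrightarrow> \<not> (U y \<and> V y))" for s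
  define I where "I \<tau> \<longleftrightarrow> reg \<tau> 10 \<le> n \<and> (\<forall>r<10. reg \<tau> r = reg \<sigma> r) \<and>
    (\<forall>a<L. mem \<tau> a = mem \<sigma> a) \<and> (\<forall>a>L + n. mem \<tau> a = 0) \<and>
    (let xs = filter good [0..<reg \<tau> 10] in
      mem \<tau> L = length xs \<and> (\<forall>j<length xs. mem \<tau> (L + 1 + j) = xs ! j))" for \<tau> :: state
  define \<sigma>\<^sub>1 where "\<sigma>\<^sub>1 = \<sigma>\<lparr>reg := (reg \<sigma>)(10 := 0)\<rparr>"
  have "I \<sigma>\<^sub>1"
    using fresh by (auto simp: I_def \<sigma>\<^sub>1_def)
  have "wp W (While (Bin Less (Reg 10) (Reg 0))
     (Assign 11 (Load (Reg 6 \<^bold>+ Reg 10) \<^bold>* Load (Reg 6 \<^bold>+ (Reg 0 \<^bold>+ Reg 0 \<^bold>+ Reg 10))) ;;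
      Assign 12 (Const 0) ;;
      test_lowest ;;
      If (Reg 11)
       (Store (Reg 9) (Load (Reg 9) \<^bold>+ Const 1) ;;
        Store (Reg 9 \<^bold>+ Load (Reg 9)) (Reg 10))
       Skip ;;
      Assign 10 (Reg 10 \<^bold>+ Const 1)))
    (\<lambda>t \<tau>. t + 2 \<le> 200 * (n * n) \<and>
      (\<forall>r<10. reg \<tau> r = reg \<sigma> r) \<and> (\<forall>a<L. mem \<tau> a = mem \<sigma> a) \<and> (\<forall>a>L + n. mem \<tau> a = 0) \<and>
      stored_list \<tau> L = lowest_members n E (\<lambda>x. U x \<and> V x)) \<sigma>\<^sub>1"
  proof (rule wp_While_less[where I = I and f = "\<lambda>\<tau>. n - reg \<tau> 10" and K = "40 * n + 60"])
    fix \<tau> assume "I \<tau>"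
    then show "exp_fits W (Reg 10) \<tau> \<and> exp_fits W (Reg 0) \<tau>"
      using regs bounds by (auto simp: I_def)
  next
    fix \<tau> assume I: "I \<tau>" and g: "exp_val (Reg 10) \<tau> < exp_val (Reg 0) \<tau>"
    define s where "s = reg \<tau> 10"
    define xs where "xs = filter good [0..<s]"
    have s: "s < n" "reg \<tau> 10 = s"
      using I g regs by (auto simp: s_def I_def)
    \<comment> \<open>At most \<open>s < n\<close> vertices have been listed, so a further one goes
      to an address of at most \<open>L + n\<close>.\<close>
    have xs: "length xs \<le> s" "mem \<tau> L = length xs" "\<forall>j<length xs. mem \<tau> (L + 1 + j) = xs ! j"
      using I length_filter_le[of good "[0..<s]"] by (auto simp: I_def xs_def s_def Let_def)
    have r: "reg \<tau> 0 = n" "reg \<tau> 3 = A" "reg \<tau> 6 = P" "reg \<tau> 9 = L"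
      using I regs by (auto simp: I_def)
    have low: "\<forall>a<L. mem \<tau> a = mem \<sigma> a"
      using I by (simp add: I_def)
    have M': "has_matrix n E A (mem \<tau>)" "has_marks n U P (mem \<tau>)" "has_marks n V (P + 2 * n) (mem \<tau>)"
      using M low bounds by (auto simp: has_marks_def intro: has_matrix_cong)
    have m: "mem \<tau> (P + s) = of_bool (U s)" "mem \<tau> (P + (2 * n + s)) = of_bool (V s)"
      using M'(2,3) s by (auto simp: has_marks_def add.assoc)
    define \<tau>\<^sub>1 where "\<tau>\<^sub>1 = \<tau>\<lparr>reg := (reg \<tau>)(11 := of_bool (U s \<and> V s), 12 := 0)\<rparr>"
    have "wp W test_lowest (\<lambda>t \<tau>. t \<le> 40 * n + 10 \<and> mem \<tau> = mem \<tau>\<^sub>1 \<and>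
      (\<forall>r. r \<noteq> 11 \<longrightarrow> r \<noteq> 12 \<longrightarrow> reg \<tau> r = reg \<tau>\<^sub>1 r) \<and>
      reg \<tau> 11 = of_bool ((U s \<and> V s) \<and> (\<forall>y<n. (s, y) \<in> E \<longrightarrow> \<not> (U y \<and> V y)))) \<tau>\<^sub>1"
      using M' r s bounds by (intro wp_test_lowest) (auto simp: \<tau>\<^sub>1_def)
    then have "wp W test_lowest (\<lambda>t. wp W
      (If (Reg 11)
       (Store (Reg 9) (Load (Reg 9) \<^bold>+ Const 1) ;;
        Store (Reg 9 \<^bold>+ Load (Reg 9)) (Reg 10))
       Skip ;;
      Assign 10 (Reg 10 \<^bold>+ Const 1)) (\<lambda>t' \<tau>'. t + t' \<le> 40 * n + 40 \<and> I \<tau>' \<and> reg \<tau>' 10 = s + 1)) \<tau>\<^sub>1"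
    proof (rule wp_mono, fold good_def, elim conjE)
      fix t and \<tau>\<^sub>2 :: state
      assume t: "t \<le> 40 * n + 10" and m2: "mem \<tau>\<^sub>2 = mem \<tau>\<^sub>1"
        and r2: "\<forall>r. r \<noteq> 11 \<longrightarrow> r \<noteq> 12 \<longrightarrow> reg \<tau>\<^sub>2 r = reg \<tau>\<^sub>1 r" "reg \<tau>\<^sub>2 11 = of_bool (good s)"
      have I2: "(\<forall>r<10. reg \<tau>\<^sub>2 r = reg \<sigma> r)" "(\<forall>a<L. mem \<tau>\<^sub>2 a = mem \<sigma> a)" "(\<forall>a>L + n. mem \<tau>\<^sub>2 a = 0)"
        using I r2 m2 by (auto simp: I_def \<tau>\<^sub>1_def)
      have xs2: "mem \<tau>\<^sub>2 L = length xs" "\<forall>j<length xs. mem \<tau>\<^sub>2 (L + 1 + j) = xs ! j" "reg \<tau>\<^sub>2 10 = s"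
        "reg \<tau>\<^sub>2 9 = L"
        using xs m2 s r r2 by (auto simp: \<tau>\<^sub>1_def)
      define \<tau>\<^sub>3 where "\<tau>\<^sub>3 = \<tau>\<^sub>2\<lparr>reg := (reg \<tau>\<^sub>2)(10 := s + 1)\<rparr>"
      define \<tau>\<^sub>4 where "\<tau>\<^sub>4 = \<tau>\<^sub>2\<lparr>mem := (mem \<tau>\<^sub>2)(L := length xs + 1, L + (length xs + 1) := s),
        reg := (reg \<tau>\<^sub>2)(10 := s + 1)\<rparr>"
      have "I \<tau>\<^sub>3" if "\<not> good s"
        using that I2 xs2 s unfolding I_def \<tau>\<^sub>3_def by (auto simp: Let_def xs_def)
      moreover have "I \<tau>\<^sub>4" if "good s"
      proof -
        have "filter good [0..<s + 1] = xs @ [s]" using that by (simp add: xs_def)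
        then show ?thesis
          using I2 xs2 xs(1) s unfolding I_def \<tau>\<^sub>4_def
          by (auto simp: Let_def nth_append less_Suc_eq)
      qed
      ultimately show "wp W
        (If (Reg 11)
         (Store (Reg 9) (Load (Reg 9) \<^bold>+ Const 1) ;;
          Store (Reg 9 \<^bold>+ Load (Reg 9)) (Reg 10))
         Skip ;;
        Assign 10 (Reg 10 \<^bold>+ Const 1)) (\<lambda>t' \<tau>'. t + t' \<le> 40 * n + 40 \<and> I \<tau>' \<and> reg \<tau>' 10 = s + 1) \<tau>\<^sub>2"
        using r2(2) xs2 xs(1) s bounds t by (cases "good s") (auto simp: \<tau>\<^sub>3_def \<tau>\<^sub>4_def)
    qed
    \<comment> \<open>The 20 steps are reserved for the two assignments ahead of the scan.\<close>
    then have "wp W test_lowest (\<lambda>t. wp W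
      (If (Reg 11)
       (Store (Reg 9) (Load (Reg 9) \<^bold>+ Const 1) ;;
        Store (Reg 9 \<^bold>+ Load (Reg 9)) (Reg 10))
       Skip ;;
      Assign 10 (Reg 10 \<^bold>+ Const 1)) (\<lambda>t' \<tau>'. 20 + (t + t') \<le> 40 * n + 60 \<and> I \<tau>' \<and>
        n - reg \<tau>' 10 < n - s)) \<tau>\<^sub>1"
      using s by (elim wp_mono) (auto simp del: wp_Seq wp_If wp_Assign elim!: wp_mono)
    then have "wp W (test_lowest ;;
      If (Reg 11)
       (Store (Reg 9) (Load (Reg 9) \<^bold>+ Const 1) ;;
        Store (Reg 9 \<^bold>+ Load (Reg 9)) (Reg 10))
       Skip ;;
      Assign 10 (Reg 10 \<^bold>+ Const 1)) (\<lambda>t \<tau>'. 20 + t \<le> 40 * n + 60 \<and> I \<tau>' \<and>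
        n - reg \<tau>' 10 < n - reg \<tau> 10) \<tau>\<^sub>1"
      by (simp only: wp_Seq[of W test_lowest] s(2))
    then show "wp W
     (Assign 11 (Load (Reg 6 \<^bold>+ Reg 10) \<^bold>* Load (Reg 6 \<^bold>+ (Reg 0 \<^bold>+ Reg 0 \<^bold>+ Reg 10))) ;;
      Assign 12 (Const 0) ;;
      test_lowest ;;
      If (Reg 11)
       (Store (Reg 9) (Load (Reg 9) \<^bold>+ Const 1) ;;
        Store (Reg 9 \<^bold>+ Load (Reg 9)) (Reg 10))
       Skip ;;
      Assign 10 (Reg 10 \<^bold>+ Const 1))
     (\<lambda>t \<tau>'. t \<le> 40 * n + 60 \<and> I \<tau>' \<and> n - reg \<tau>' 10 < n - reg \<tau> 10) \<tau>"
      \<comment> \<open>Splitting only at the two assignments lets the simplifier execute them and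
        stop at \<open>test_lowest\<close>, where the fact just proved is used as a whole.\<close>
      unfolding wp_Seq[of _ "Assign 11 _"] wp_Seq[of _ "Assign 12 _"]
      using r m s bounds
      by (auto simp: \<tau>\<^sub>1_def mult_2[symmetric] of_bool_conj[symmetric] simp del: wp_Seq elim!: wp_mono)
  next
    fix t \<tau>
    assume I: "I \<tau>" and ge: "exp_val (Reg 0) \<tau> \<le> exp_val (Reg 10) \<tau>"
      and t: "t \<le> (n - reg \<sigma>\<^sub>1 10) * (40 * n + 60 + exp_cost (Reg 10) + exp_cost (Reg 0) + 2)
        + exp_cost (Reg 10) + exp_cost (Reg 0) + 2"
    have "reg \<tau> 10 = n"
      using ge I regs by (auto simp: I_def)
    then have "stored_list \<tau> L = filter good [0..<n]"
      using I by (auto simp: I_def Let_def stored_list_def intro!: nth_equalityI)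
    then have "stored_list \<tau> L = lowest_members n E (\<lambda>x. U x \<and> V x)"
      by (simp add: lowest_members_def good_def[abs_def])
    moreover have "t \<le> 64 * n + 40 * (n * n) + 4"
      using t by (simp add: \<sigma>\<^sub>1_def algebra_simps)
    moreover have "n \<le> n * n" "1 \<le> n * n" using n_pos by auto
    ultimately have "t + 2 \<le> 200 * (n * n)" "stored_list \<tau> L = lowest_members n E (\<lambda>x. U x \<and> V x)"
      by (linarith, blast)
    then show "t + 2 \<le> 200 * (n * n) \<and>
      (\<forall>r<10. reg \<tau> r = reg \<sigma> r) \<and> (\<forall>a<L. mem \<tau> a = mem \<sigma> a) \<and> (\<forall>a>L + n. mem \<tau> a = 0) \<and>
      stored_list \<tau> L = lowest_members n E (\<lambda>x. U x \<and> V x)"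
      using I by (simp add: I_def)
  qed (use bounds \<open>I \<sigma>\<^sub>1\<close> in auto)
  then show ?thesis
    unfolding collect_lowest_def wp_Seq[of _ "Assign 10 _"]
    by (auto simp: \<sigma>\<^sub>1_def simp del: wp_Seq elim!: wp_mono)
qed

end


section \<open>The answer to a single pair\<close>

definition pair_answer :: "nat \<Rightarrow> (nat \<times> nat) set \<Rightarrow> nat \<times> nat \<Rightarrow> nat list" where
  "pair_answer n E = (\<lambda>(u, v). if u = v then []
    else lowest_members n E (\<lambda>x. (x, u) \<in> E\<^sup>* \<and> (x, v) \<in> E\<^sup>*))"

lemma length_pair_answer: "length (pair_answer n E p) \<le> n"
  using length_filter_le[of _ "[0..<n]"]
  by (auto simp: pair_answer_def lowest_members_def split: prod.split)

lemma length_flatten_pairs [simp]: "length (flatten_pairs xs) = 2 * length xs"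
  by (induction xs) (auto simp: flatten_pairs_def)

lemma flatten_pairs_nth:
  assumes "i < length xs"
  shows "flatten_pairs xs ! (2 * i) = fst (xs ! i)" "flatten_pairs xs ! Suc (2 * i) = snd (xs ! i)"
  using assms
  by (induction xs arbitrary: i) (auto simp: flatten_pairs_def less_Suc_eq_0_disj)

lemma stored_list_cong:
  assumes "\<And>a. p \<le> a \<Longrightarrow> a \<le> p + mem \<sigma> p \<Longrightarrow> mem \<tau> a = mem \<sigma> a"
  shows "stored_list \<tau> p = stored_list \<sigma> p"
  using assms unfolding stored_list_def by auto

lemma length_stored_list [simp]: "length (stored_list \<sigma> p) = mem \<sigma> p"
  by (simp add: stored_list_def)

text \<open>150 for either search and 200 for the collection make 500; the rest absorbs the register
  assignments, as \<open>1 \<le> n * n\<close>. The second search finds its fresh cells at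
  \<open>P + 2 * n\<close>, exactly where the first one leaves memory 0.\<close>

lemma (in memory_layout) wp_distinct_pair:
  assumes regs: "reg \<sigma> 0 = n" "reg \<sigma> 3 = A" "reg \<sigma> 6 = P" "reg \<sigma> 7 = u" "reg \<sigma> 8 = v"
      "reg \<sigma> 9 = P + 4 * n"
    and uv: "u < n" "v < n" "u \<noteq> v"
    and M: "has_matrix n E A (mem \<sigma>)" and fresh: "\<forall>a\<ge>P. mem \<sigma> a = 0"
    and bounds: "A + n * n \<le> P" "P + 5 * n < W"
  shows "wp W
     (Assign 10 (Reg 6) ;; Assign 11 (Reg 7) ;; mark_ancestors ;;
      Assign 10 (Reg 6 \<^bold>+ (Reg 0 \<^bold>+ Reg 0)) ;; Assign 11 (Reg 8) ;; mark_ancestors ;;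
      collect_lowest)
    (\<lambda>t \<tau>. t \<le> 550 * (n * n) \<and> (\<forall>r<10. reg \<tau> r = reg \<sigma> r) \<and> (\<forall>a<P. mem \<tau> a = mem \<sigma> a) \<and>
      (\<forall>a>P + 5 * n. mem \<tau> a = 0) \<and> stored_list \<tau> (P + 4 * n) = pair_answer n E (u, v)) \<sigma>"
proof -
  define anc where "anc w x \<longleftrightarrow> (x, w) \<in> E\<^sup>*" for w x
  \<comment> \<open>The phases are treated from last to first, since \<open>wp_Seq\<close> turns
    what follows into a postcondition.\<close>
  have collect: "wp W collect_lowest (\<lambda>t \<tau>. t \<le> 200 * (n * n) \<and>
      (\<forall>r<10. reg \<tau> r = reg \<sigma> r) \<and> (\<forall>a<P. mem \<tau> a = mem \<sigma> a) \<and> (\<forall>a>P + 5 * n. mem \<tau> a = 0) \<and>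
      stored_list \<tau> (P + 4 * n) = pair_answer n E (u, v)) \<sigma>'"
    if "\<forall>r<10. reg \<sigma>' r = reg \<sigma> r" "\<forall>a<P. mem \<sigma>' a = mem \<sigma> a" "\<forall>a\<ge>P + 4 * n. mem \<sigma>' a = 0"
      "has_marks n (anc u) P (mem \<sigma>')" "has_marks n (anc v) (P + 2 * n) (mem \<sigma>')" for \<sigma>'
  proof -
    have "has_matrix n E A (mem \<sigma>')"
      using M that(2) bounds by (auto intro: has_matrix_cong)
    then have "wp W collect_lowest (\<lambda>t \<tau>. t \<le> 200 * (n * n) \<and>
        (\<forall>r<10. reg \<tau> r = reg \<sigma>' r) \<and> (\<forall>a<P + 4 * n. mem \<tau> a = mem \<sigma>' a) \<and>
        (\<forall>a>P + 4 * n + n. mem \<tau> a = 0) \<and>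
        stored_list \<tau> (P + 4 * n) = lowest_members n E (\<lambda>x. anc u x \<and> anc v x)) \<sigma>'"
      using that regs bounds by (intro wp_collect_lowest) auto
    then show ?thesis
      using that uv(3) by (elim wp_mono) (auto simp: pair_answer_def anc_def)
  qed
  have second: "wp W
     (Assign 10 (Reg 6 \<^bold>+ (Reg 0 \<^bold>+ Reg 0)) ;; Assign 11 (Reg 8) ;; mark_ancestors ;; collect_lowest)
     (\<lambda>t \<tau>. t \<le> 350 * (n * n) + 10 \<and>
      (\<forall>r<10. reg \<tau> r = reg \<sigma> r) \<and> (\<forall>a<P. mem \<tau> a = mem \<sigma> a) \<and> (\<forall>a>P + 5 * n. mem \<tau> a = 0) \<and>
      stored_list \<tau> (P + 4 * n) = pair_answer n E (u, v)) \<sigma>'"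
    if "\<forall>r<10. reg \<sigma>' r = reg \<sigma> r" "\<forall>a<P. mem \<sigma>' a = mem \<sigma> a" "\<forall>a\<ge>P + 2 * n. mem \<sigma>' a = 0"
      "has_marks n (anc u) P (mem \<sigma>')" for \<sigma>'
  proof -
    define \<sigma>\<^sub>1 where "\<sigma>\<^sub>1 = \<sigma>'\<lparr>reg := (reg \<sigma>')(10 := P + 2 * n, 11 := v)\<rparr>"
    have "has_matrix n E A (mem \<sigma>')"
      using M that(2) bounds by (auto intro: has_matrix_cong)
    then have "wp W mark_ancestors (\<lambda>t \<tau>. t \<le> 150 * (n * n) \<and>
      (\<forall>r<12. reg \<tau> r = reg \<sigma>\<^sub>1 r) \<and> (\<forall>a<P + 2 * n. mem \<tau> a = mem \<sigma>\<^sub>1 a) \<and>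
      (\<forall>a\<ge>P + 2 * n + 2 * n. mem \<tau> a = 0) \<and>
      (\<forall>x<n. mem \<tau> (P + 2 * n + x) = of_bool ((x, v) \<in> E\<^sup>*))) \<sigma>\<^sub>1"
      using that regs uv bounds by (intro wp_mark_ancestors) (auto simp: \<sigma>\<^sub>1_def)
    then have "wp W mark_ancestors (\<lambda>t. wp W collect_lowest (\<lambda>t' \<tau>. 10 + (t + t') \<le> 350 * (n * n) + 10 \<and>
      (\<forall>r<10. reg \<tau> r = reg \<sigma> r) \<and> (\<forall>a<P. mem \<tau> a = mem \<sigma> a) \<and> (\<forall>a>P + 5 * n. mem \<tau> a = 0) \<and>
      stored_list \<tau> (P + 4 * n) = pair_answer n E (u, v))) \<sigma>\<^sub>1"
    proof (rule wp_mono, elim conjE)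
      fix t and \<tau> :: state
      assume *: "t \<le> 150 * (n * n)" "\<forall>r<12. reg \<tau> r = reg \<sigma>\<^sub>1 r" "\<forall>a<P + 2 * n. mem \<tau> a = mem \<sigma>\<^sub>1 a"
        "\<forall>a\<ge>P + 2 * n + 2 * n. mem \<tau> a = 0"
        "\<forall>x<n. mem \<tau> (P + 2 * n + x) = of_bool ((x, v) \<in> E\<^sup>*)"
      show "wp W collect_lowest (\<lambda>t' \<tau>. 10 + (t + t') \<le> 350 * (n * n) + 10 \<and>
        (\<forall>r<10. reg \<tau> r = reg \<sigma> r) \<and> (\<forall>a<P. mem \<tau> a = mem \<sigma> a) \<and> (\<forall>a>P + 5 * n. mem \<tau> a = 0) \<and>
        stored_list \<tau> (P + 4 * n) = pair_answer n E (u, v)) \<tau>"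
        by (rule wp_mono[OF collect])
          (use * that in \<open>auto simp: \<sigma>\<^sub>1_def has_marks_def anc_def\<close>)
    qed
    then show ?thesis
      using that(1) regs uv bounds by (auto simp: \<sigma>\<^sub>1_def mult_2 elim!: wp_mono)
  qed
  define \<sigma>\<^sub>1 where "\<sigma>\<^sub>1 = \<sigma>\<lparr>reg := (reg \<sigma>)(10 := P, 11 := u)\<rparr>"
  have "wp W mark_ancestors (\<lambda>t \<tau>. t \<le> 150 * (n * n) \<and>
      (\<forall>r<12. reg \<tau> r = reg \<sigma>\<^sub>1 r) \<and> (\<forall>a<P. mem \<tau> a = mem \<sigma>\<^sub>1 a) \<and>
      (\<forall>a\<ge>P + 2 * n. mem \<tau> a = 0) \<and>
      (\<forall>x<n. mem \<tau> (P + x) = of_bool ((x, u) \<in> E\<^sup>*))) \<sigma>\<^sub>1"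
    using M fresh regs uv bounds by (intro wp_mark_ancestors) (auto simp: \<sigma>\<^sub>1_def)
  then have "wp W mark_ancestors (\<lambda>t. wp W
     (Assign 10 (Reg 6 \<^bold>+ (Reg 0 \<^bold>+ Reg 0)) ;; Assign 11 (Reg 8) ;; mark_ancestors ;; collect_lowest)
     (\<lambda>t' \<tau>. 4 + (t + t') \<le> 550 * (n * n) \<and>
      (\<forall>r<10. reg \<tau> r = reg \<sigma> r) \<and> (\<forall>a<P. mem \<tau> a = mem \<sigma> a) \<and> (\<forall>a>P + 5 * n. mem \<tau> a = 0) \<and>
      stored_list \<tau> (P + 4 * n) = pair_answer n E (u, v))) \<sigma>\<^sub>1"
  proof (rule wp_mono, elim conjE)
    fix t and \<tau> :: state
    assume *: "t \<le> 150 * (n * n)" "\<forall>r<12. reg \<tau> r = reg \<sigma>\<^sub>1 r" "\<forall>a<P. mem \<tau> a = mem \<sigma>\<^sub>1 a"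
      "\<forall>a\<ge>P + 2 * n. mem \<tau> a = 0"
      "\<forall>x<n. mem \<tau> (P + x) = of_bool ((x, u) \<in> E\<^sup>*)"
    have "1 \<le> n * n" using n_pos by auto
    then have time: "4 + (t + t') \<le> 550 * (n * n)" if "t' \<le> 350 * (n * n) + 10" for t'
      using that *(1) by linarith
    show "wp W
     (Assign 10 (Reg 6 \<^bold>+ (Reg 0 \<^bold>+ Reg 0)) ;; Assign 11 (Reg 8) ;; mark_ancestors ;; collect_lowest)
     (\<lambda>t' \<tau>. 4 + (t + t') \<le> 550 * (n * n) \<and>
      (\<forall>r<10. reg \<tau> r = reg \<sigma> r) \<and> (\<forall>a<P. mem \<tau> a = mem \<sigma> a) \<and> (\<forall>a>P + 5 * n. mem \<tau> a = 0) \<and>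
      stored_list \<tau> (P + 4 * n) = pair_answer n E (u, v)) \<tau>"
    proof (rule wp_mono[OF second])
    qed (use * time in \<open>auto simp: \<sigma>\<^sub>1_def has_marks_def anc_def\<close>)
  qed
  then show ?thesis
    unfolding wp_Seq[of _ "Assign 10 (Reg 6)"] wp_Seq[of _ "Assign 11 (Reg 7)"] wp_Seq[of _ mark_ancestors]
    using regs uv bounds by (auto simp: \<sigma>\<^sub>1_def simp del: wp_Seq elim!: wp_mono)
qed


section \<open>Writing the adjacency matrix\<close>

lemma wp_build_matrix:
  assumes regs: "reg \<sigma> 0 = n" "reg \<sigma> 1 = length as" "reg \<sigma> 2 = k"
    and A: "A = 2 * (length as + k)"
    and arcs: "set as \<subseteq> {..<n} \<times> {..<n}"
    and M: "\<forall>i<length as. mem \<sigma> (2 * i) = fst (as ! i) \<and> mem \<sigma> (2 * i + 1) = snd (as ! i)"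
    and fresh: "\<forall>a\<ge>A. mem \<sigma> a = 0"
    and bounds: "A + n * n + n + 4 \<le> W"
  shows "wp W build_matrix (\<lambda>t \<tau>. t \<le> 50 * length as + 30 \<and>
    (\<forall>r<10. r \<noteq> 3 \<longrightarrow> reg \<tau> r = reg \<sigma> r) \<and> reg \<tau> 3 = A \<and> (\<forall>a<A. mem \<tau> a = mem \<sigma> a) \<and>
    (\<forall>a\<ge>A + n * n. mem \<tau> a = 0) \<and> has_matrix n (set as) A (mem \<tau>)) \<sigma>"
proof -
  define \<sigma>\<^sub>1 where "\<sigma>\<^sub>1 = \<sigma>\<lparr>reg := (reg \<sigma>)(3 := A, 10 := 0)\<rparr>"
  define I where "I \<tau> \<longleftrightarrow> (\<exists>j\<le>length as. reg \<tau> 10 = 2 * j \<and> (\<forall>r<10. reg \<tau> r = reg \<sigma>\<^sub>1 r) \<and>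
    (\<forall>a<A. mem \<tau> a = mem \<sigma> a) \<and> (\<forall>a\<ge>A + n * n. mem \<tau> a = 0) \<and>
    has_matrix n (set (take j as)) A (mem \<tau>))" for \<tau> :: state
  have "I \<sigma>\<^sub>1"
    using fresh unfolding I_def by (auto intro!: exI[of _ 0] simp: \<sigma>\<^sub>1_def has_matrix_def)
  have "wp W
    (While (Bin Less (Reg 10) (Reg 1 \<^bold>+ Reg 1))
     (Store (Reg 3 \<^bold>+ (Reg 0 \<^bold>* Load (Reg 10 \<^bold>+ Const 1) \<^bold>+ Load (Reg 10))) (Const 1) ;;
      Assign 10 (Reg 10 \<^bold>+ Const 2)))
   (\<lambda>t \<tau>. 20 + t \<le> 50 * length as + 30 \<and>
    (\<forall>r<10. r \<noteq> 3 \<longrightarrow> reg \<tau> r = reg \<sigma> r) \<and> reg \<tau> 3 = A \<and> (\<forall>a<A. mem \<tau> a = mem \<sigma> a) \<and>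
    (\<forall>a\<ge>A + n * n. mem \<tau> a = 0) \<and> has_matrix n (set as) A (mem \<tau>)) \<sigma>\<^sub>1"
  \<comment> \<open>The loop advances by 2, but the variant counts cells: each of its
    \<open>2 * length as\<close> units is charged a full iteration of 23 steps, and 46 stays below
    50.\<close>
  proof (rule wp_While_less[where I = I and f = "\<lambda>\<tau>. 2 * length as - reg \<tau> 10" and K = 17])
    fix \<tau> assume "I \<tau>"
    then show "exp_fits W (Reg 10) \<tau> \<and> exp_fits W (Reg 1 \<^bold>+ Reg 1) \<tau>"
      using regs A bounds by (auto simp: I_def \<sigma>\<^sub>1_def)
  next
    fix \<tau> assume "I \<tau>" and g: "exp_val (Reg 10) \<tau> < exp_val (Reg 1 \<^bold>+ Reg 1) \<tau>"
    then obtain j where j: "j \<le> length as" "reg \<tau> 10 = 2 * j" "\<forall>r<10. reg \<tau> r = reg \<sigma>\<^sub>1 r"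
      "\<forall>a<A. mem \<tau> a = mem \<sigma> a" "\<forall>a\<ge>A + n * n. mem \<tau> a = 0"
      "has_matrix n (set (take j as)) A (mem \<tau>)"
      unfolding I_def by blast
    have r: "reg \<tau> 0 = n" "reg \<tau> 1 = length as" "reg \<tau> 3 = A"
      using j(3) regs by (auto simp: \<sigma>\<^sub>1_def)
    have jl: "j < length as"
      using g r j by simp
    obtain x y where xy: "as ! j = (x, y)" by fastforce
    then have "x < n" "y < n"
      using arcs jl nth_mem[OF jl] by auto
    have idx: "n * y + x < n * n"
      using matrix_index_less \<open>x < n\<close> \<open>y < n\<close> by blast
    have m: "mem \<tau> (2 * j) = x" "mem \<tau> (Suc (2 * j)) = y"
      using M j(4) jl xy A by auto
    define \<tau>' where "\<tau>' = \<tau>\<lparr>mem := (mem \<tau>)(A + (n * y + x) := 1),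
      reg := (reg \<tau>)(10 := 2 * j + 2)\<rparr>"
    \<comment> \<open>Distinct entries have distinct addresses, as division by \<open>n\<close>
      recovers the row; so the store changes no other entry.\<close>
    have "n * y' + x' = n * y + x \<longleftrightarrow> y' = y \<and> x' = x" if "x' < n" for x' y'
    proof
      assume eq: "n * y' + x' = n * y + x"
      then have "(n * y' + x') div n = (n * y + x) div n" by simp
      then have "y' = y" using that \<open>x < n\<close> by simp
      then show "y' = y \<and> x' = x" using eq by simp
    qed auto
    then have "has_matrix n (set (take (j + 1) as)) A (mem \<tau>')"
      using j(6) jl xy unfolding has_matrix_def \<tau>'_def by (auto simp: take_Suc_conv_app_nth)
    then have "I \<tau>'"
      unfolding I_def using j jl idx
      by (intro exI[of _ "j + 1"]) (auto simp: \<tau>'_def)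
    then show "wp W
     (Store (Reg 3 \<^bold>+ (Reg 0 \<^bold>* Load (Reg 10 \<^bold>+ Const 1) \<^bold>+ Load (Reg 10))) (Const 1) ;;
      Assign 10 (Reg 10 \<^bold>+ Const 2))
     (\<lambda>t \<tau>'. t \<le> 17 \<and> I \<tau>' \<and> 2 * length as - reg \<tau>' 10 < 2 * length as - reg \<tau> 10) \<tau>"
      using r j(2) m idx bounds jl \<open>x < n\<close> \<open>y < n\<close> A by (auto simp: \<tau>'_def)
  next
    fix t \<tau>
    assume "I \<tau>" and ge: "exp_val (Reg 1 \<^bold>+ Reg 1) \<tau> \<le> exp_val (Reg 10) \<tau>"
      and t: "t \<le> (2 * length as - reg \<sigma>\<^sub>1 10) * (17 + exp_cost (Reg 10) + exp_cost (Reg 1 \<^bold>+ Reg 1) + 2)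
        + exp_cost (Reg 10) + exp_cost (Reg 1 \<^bold>+ Reg 1) + 2"
    then obtain j where j: "j \<le> length as" "reg \<tau> 10 = 2 * j" "\<forall>r<10. reg \<tau> r = reg \<sigma>\<^sub>1 r"
      "\<forall>a<A. mem \<tau> a = mem \<sigma> a" "\<forall>a\<ge>A + n * n. mem \<tau> a = 0"
      "has_matrix n (set (take j as)) A (mem \<tau>)"
      unfolding I_def by blast
    have "j = length as"
      using ge j(1-3) regs by (simp add: \<sigma>\<^sub>1_def)
    then show "20 + t \<le> 50 * length as + 30 \<and>
      (\<forall>r<10. r \<noteq> 3 \<longrightarrow> reg \<tau> r = reg \<sigma> r) \<and> reg \<tau> 3 = A \<and> (\<forall>a<A. mem \<tau> a = mem \<sigma> a) \<and>
      (\<forall>a\<ge>A + n * n. mem \<tau> a = 0) \<and> has_matrix n (set as) A (mem \<tau>)"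
      using j t by (auto simp: \<sigma>\<^sub>1_def)
  qed (use bounds \<open>I \<sigma>\<^sub>1\<close> in auto)
  moreover have "length as + k + (length as + k) = A" "length as + k \<le> A"
    using A by simp_all
  ultimately show ?thesis
    unfolding build_matrix_def using regs bounds
    by (auto simp: \<sigma>\<^sub>1_def elim!: wp_mono)
qed


section \<open>Answering all pairs\<close>

lemma arcs_ends_arc_digraph [simp]: "arcs_ends (arc_digraph n as) = set as"
  by (force simp: arc_digraph_def arcs_ends_def arc_to_ends_def)

lemma verts_arc_digraph [simp]: "verts (arc_digraph n as) = {..<n}"
  by (simp add: arc_digraph_def)

lemma dag_input_arcs_subset:
  assumes "dag_input n as"
  shows "set as \<subseteq> {..<n} \<times> {..<n}"
proof -
  interpret digraph "arc_digraph n as"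
    using assms by (simp add: dag_input_def dag_def)
  have "x < n \<and> y < n" if "(x, y) \<in> set as" for x y
    using adj_in_verts[of x y] that by simp
  then show ?thesis by auto
qed

text \<open>Supplies a valid instance for every positive \<open>n\<close>, so that \<open>n\<close>
  can grow in the argument on the exponent.\<close>

lemma dag_input_Nil: "0 < n \<Longrightarrow> dag_input n []"
  unfolding dag_input_def dag_def
  by (auto simp: acyclic_def, unfold_locales) (auto simp: arc_digraph_def)

text \<open>Graph reachability is reflexive only on vertices, whereas
  \<open>(set as)\<^sup>*\<close> is reflexive everywhere; \<open>u < n\<close> bridges the
  difference.\<close>

lemma reachable_arc_digraph:
  assumes "dag_input n as" "u < n"
  shows "s \<rightarrow>\<^sup>*\<^bsub>arc_digraph n as\<^esub> u \<longleftrightarrow> (s, u) \<in> (set as)\<^sup>*"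
proof -
  interpret digraph "arc_digraph n as"
    using assms by (simp add: dag_input_def dag_def)
  show ?thesis
  proof
    assume "(s, u) \<in> (set as)\<^sup>*"
    then show "s \<rightarrow>\<^sup>*\<^bsub>arc_digraph n as\<^esub> u"
    proof (induction rule: converse_rtrancl_induct)
      case base
      then show ?case using assms(2) by simp
    next
      case (step y z)
      then show ?case using adj_reachable_trans[of y z u] by simp
    qed
  next
    assume "s \<rightarrow>\<^sup>*\<^bsub>arc_digraph n as\<^esub> u"
    then show "(s, u) \<in> (set as)\<^sup>*"
    proof (induction rule: converse_reachable_induct)
      case (step x y)
      then show ?case by (simp add: converse_rtrancl_into_rtrancl)
    qed simp
  qed
qed

lemma pair_answer_correct:
  assumes "dag_input n as" "u < n" "v < n"
  shows "distinct (pair_answer n (set as) (u, v))"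
    "set (pair_answer n (set as) (u, v)) = {s. lca (arc_digraph n as) u v s}"
proof -
  show "distinct (pair_answer n (set as) (u, v))"
    by (simp add: pair_answer_def lowest_members_def)
  define anc where "anc x \<longleftrightarrow> (x, u) \<in> (set as)\<^sup>* \<and> (x, v) \<in> (set as)\<^sup>*" for x
  have dag: "dag (arc_digraph n as)"
    using assms(1) by (simp add: dag_input_def)
  have "common_ancestor (arc_digraph n as) u v x \<longleftrightarrow> anc x" for x
    using reachable_arc_digraph[OF assms(1)] assms(2,3) by (simp add: common_ancestor_def anc_def)
  \<comment> \<open>The program looks only at numbers below \<open>n\<close>; this fact and the next
    show that the filter misses no common ancestor and its bounded quantifier no
    out-neighbour.\<close>
  moreover have "s < n" if "anc s" for s
    using that dag_input_arcs_subset[OF assms(1)] assms(2)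
    by (auto simp: anc_def elim: converse_rtranclE)
  moreover have "y < n" if "(x, y) \<in> set as" for x y
    using that dag_input_arcs_subset[OF assms(1)] by auto
  ultimately show "set (pair_answer n (set as) (u, v)) = {s. lca (arc_digraph n as) u v s}"
    unfolding lca_iff_common_ancestor[OF dag]
    by (auto simp: pair_answer_def lowest_members_def anc_def[symmetric])
qed

text \<open>\<open>W_ge\<close> adds up the memory map: input, matrix, pointer table,
  \<open>5 * n + 1\<close> cells per pair, and a little slack.\<close>

locale lca_instance =
  fixes n W :: nat and as ps :: "(nat \<times> nat) list"
  assumes input: "dag_input n as" "set ps \<subseteq> {..<n} \<times> {..<n}"
    and W_ge: "2 * (length as + length ps) + n * n + length ps + length ps * (5 * n + 1) + n + 4 \<le> W"
begin

abbreviation "m \<equiv> length as"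
abbreviation "k \<equiv> length ps"
abbreviation "A \<equiv> 2 * (m + k)"
abbreviation "table \<equiv> A + n * n"

sublocale memory_layout W n A "set as"
  using input dag_input_arcs_subset by unfold_locales (auto simp: dag_input_def)

definition area :: "nat \<Rightarrow> nat" where
  "area i = table + k + i * (5 * n + 1)"

lemma area_le:
  assumes "i \<le> k"
  shows "area i + n + 4 \<le> W"
  using mult_le_mono1[OF assms, of "5 * n + 1"] W_ge by (simp add: area_def)

lemma area_Suc: "area (Suc i) = area i + 5 * n + 1"
  by (simp add: area_def)

lemma table_less_area: "i < k \<Longrightarrow> table + i < area j"
  by (simp add: area_def)

text \<open>Requiring each list to start behind the table and to end before \<open>area i\<close> is
  what protects it: below \<open>area i\<close>, the next round changes only entry \<open>i\<close>
  of the table.\<close>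

definition answered :: "nat \<Rightarrow> state \<Rightarrow> bool" where
  "answered i \<sigma> \<longleftrightarrow>
    reg \<sigma> 0 = n \<and> reg \<sigma> 1 = m \<and> reg \<sigma> 2 = k \<and> reg \<sigma> 3 = A \<and> reg \<sigma> 4 = table \<and> reg \<sigma> 5 = i \<and>
    reg \<sigma> 6 = area i \<and> has_matrix n (set as) A (mem \<sigma>) \<and>
    (\<forall>j<k. mem \<sigma> (2 * m + 2 * j) = fst (ps ! j) \<and> mem \<sigma> (2 * m + 2 * j + 1) = snd (ps ! j)) \<and>
    (\<forall>a\<ge>area i. mem \<sigma> a = 0) \<and>
    (\<forall>j<i. table + k \<le> mem \<sigma> (table + j) \<and>
      mem \<sigma> (table + j) + mem \<sigma> (mem \<sigma> (table + j)) < area i \<and>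
      stored_list \<sigma> (mem \<sigma> (table + j)) = pair_answer n (set as) (ps ! j))"

lemma answered_Suc:
  assumes \<sigma>: "answered i \<sigma>" and i: "i < k"
    and regs: "\<And>r. r < 5 \<Longrightarrow> reg \<tau> r = reg \<sigma> r" "reg \<tau> 5 = i + 1" "reg \<tau> 6 = area (i + 1)"
    and frame: "\<And>a. a < area i \<Longrightarrow> a \<noteq> table + i \<Longrightarrow> mem \<tau> a = mem \<sigma> a"
    and fresh: "\<And>a. area (i + 1) \<le> a \<Longrightarrow> mem \<tau> a = 0"
    and entry: "mem \<tau> (table + i) = area i + 4 * n"
    and answer: "stored_list \<tau> (area i + 4 * n) = pair_answer n (set as) (ps ! i)"
  shows "answered (i + 1) \<tau>"
proof -
  have below: "table + i < area i"
    using i by (rule table_less_area)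
  have "has_matrix n (set as) A (mem \<tau>)"
    using \<sigma> frame below by (auto simp: answered_def intro: has_matrix_cong)
  moreover have "mem \<tau> (2 * m + 2 * j) = mem \<sigma> (2 * m + 2 * j)"
    "mem \<tau> (2 * m + 2 * j + 1) = mem \<sigma> (2 * m + 2 * j + 1)" if "j < k" for j
    using frame that below by auto
  moreover have "table + k \<le> mem \<tau> (table + j) \<and>
      mem \<tau> (table + j) + mem \<tau> (mem \<tau> (table + j)) < area (i + 1) \<and>
      stored_list \<tau> (mem \<tau> (table + j)) = pair_answer n (set as) (ps ! j)" if "j < i + 1" for j
  proof (cases "j = i")
    case True
    \<comment> \<open>An answer has at most \<open>n\<close> entries, so it ends at
      \<open>area i + 5 * n\<close> at the latest, the last cell of this area.\<close>
    have "mem \<tau> (area i + 4 * n) \<le> n"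
      using length_pair_answer answer length_stored_list by metis
    then show ?thesis
      using True entry answer by (auto simp: area_def)
  next
    case False
    then have j: "j < i" using that by simp
    have "mem \<tau> (table + j) = mem \<sigma> (table + j)"
      using frame[of "table + j"] j below by simp
    moreover define p where "p = mem \<sigma> (table + j)"
    ultimately have p: "table + k \<le> p" "p + mem \<sigma> p < area i"
        "stored_list \<sigma> p = pair_answer n (set as) (ps ! j)" "mem \<tau> (table + j) = p"
      using \<sigma> j by (auto simp: answered_def)
    have "mem \<tau> a = mem \<sigma> a" if "p \<le> a" "a \<le> p + mem \<sigma> p" for a
      using frame[of a] p that i by simp
    then have "stored_list \<tau> p = stored_list \<sigma> p" "mem \<tau> p = mem \<sigma> p"
      by (auto intro: stored_list_cong)
    then show ?thesis
      using p area_Suc[of i] by simp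
  qed
  ultimately show ?thesis
    using \<sigma> regs fresh unfolding answered_def by simp
qed

lemma wp_answer_pair:
  assumes \<sigma>: "answered i \<sigma>" and i: "i < k"
  shows "wp W answer_pair (\<lambda>t \<tau>. t \<le> 700 * (n * n) \<and> answered (i + 1) \<tau>) \<sigma>"
proof -
  define P where "P = area i"
  obtain u v where uv: "ps ! i = (u, v)" by fastforce
  then have "u < n" "v < n"
    using input(2) nth_mem[OF i] by auto
  have r: "reg \<sigma> 0 = n" "reg \<sigma> 1 = m" "reg \<sigma> 2 = k" "reg \<sigma> 3 = A" "reg \<sigma> 4 = table" "reg \<sigma> 5 = i"
    "reg \<sigma> 6 = P"
    using \<sigma> by (auto simp: answered_def P_def)
  have args: "mem \<sigma> (2 * m + 2 * i) = u" "mem \<sigma> (2 * m + 2 * i + 1) = v"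
    using \<sigma> i uv by (auto simp: answered_def)
  have bounds: "P + 6 * n + 5 \<le> W" "table + i < P" "A + n * n \<le> P"
    using area_le[of "Suc i"] area_Suc[of i] table_less_area[OF i, of i] i by (auto simp: P_def)
  define \<sigma>\<^sub>1 where "\<sigma>\<^sub>1 = \<sigma>\<lparr>reg := (reg \<sigma>)(7 := u, 8 := v, 9 := P + 4 * n),
    mem := (mem \<sigma>)(table + i := P + 4 * n)\<rparr>"
  have M: "has_matrix n (set as) A (mem \<sigma>\<^sub>1)"
    using \<sigma> by (auto simp: answered_def \<sigma>\<^sub>1_def intro: has_matrix_cong)
  have fresh: "\<forall>a\<ge>P. mem \<sigma>\<^sub>1 a = 0"
    using \<sigma> bounds by (auto simp: answered_def \<sigma>\<^sub>1_def P_def)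
  let ?branch = "Assign 10 (Reg 6) ;; Assign 11 (Reg 7) ;; mark_ancestors ;;
      Assign 10 (Reg 6 \<^bold>+ (Reg 0 \<^bold>+ Reg 0)) ;; Assign 11 (Reg 8) ;; mark_ancestors ;;
      collect_lowest"
  let ?post = "\<lambda>\<tau>. (\<forall>r<10. reg \<tau> r = reg \<sigma>\<^sub>1 r) \<and> (\<forall>a<P. mem \<tau> a = mem \<sigma>\<^sub>1 a) \<and>
      (\<forall>a>P + 5 * n. mem \<tau> a = 0) \<and> stored_list \<tau> (P + 4 * n) = pair_answer n (set as) (u, v)"
  have branch: "wp W (if u = v then Skip else ?branch) (\<lambda>t \<tau>. t \<le> 550 * (n * n) \<and> ?post \<tau>) \<sigma>\<^sub>1"
  proof (cases "u = v")
    case True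
    then have "stored_list \<sigma>\<^sub>1 (P + 4 * n) = pair_answer n (set as) (u, v)"
      using fresh by (simp add: stored_list_def pair_answer_def)
    moreover have "1 \<le> n * n" using n_pos by simp
    ultimately show ?thesis
      using True fresh by simp
  next
    case False
    then have "wp W ?branch (\<lambda>t \<tau>. t \<le> 550 * (n * n) \<and> ?post \<tau>) \<sigma>\<^sub>1"
      using \<open>u < n\<close> \<open>v < n\<close> M fresh bounds r
      by (intro wp_distinct_pair) (auto simp: \<sigma>\<^sub>1_def)
    then show ?thesis using False by simp
  qed
  let ?rest = "Assign 6 (Reg 9 \<^bold>+ Reg 0 \<^bold>+ Const 1) ;; Assign 5 (Reg 5 \<^bold>+ Const 1)"
  have "wp W (if u = v then Skip else ?branch)
    (\<lambda>t. wp W ?rest (\<lambda>t' \<tau>. 50 + (t + t') \<le> 700 * (n * n) \<and> answered (i + 1) \<tau>)) \<sigma>\<^sub>1"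
  proof (rule wp_mono[OF branch], elim conjE)
    fix t and \<tau> :: state
    assume t: "t \<le> 550 * (n * n)" and \<tau>: "\<forall>r<10. reg \<tau> r = reg \<sigma>\<^sub>1 r" "\<forall>a<P. mem \<tau> a = mem \<sigma>\<^sub>1 a"
      "\<forall>a>P + 5 * n. mem \<tau> a = 0" "stored_list \<tau> (P + 4 * n) = pair_answer n (set as) (u, v)"
    have r\<tau>: "reg \<tau> 0 = n" "reg \<tau> 5 = i" "reg \<tau> 9 = P + 4 * n"
      using \<tau>(1) r by (auto simp: \<sigma>\<^sub>1_def)
    define \<tau>' where "\<tau>' = \<tau>\<lparr>reg := (reg \<tau>)(6 := P + 4 * n + n + 1, 5 := i + 1)\<rparr>"
    have "stored_list \<tau>' p = stored_list \<tau> p" for p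
      by (rule stored_list_cong) (simp add: \<tau>'_def)
    then have "answered (i + 1) \<tau>'"
      using \<tau> r bounds uv
      by (intro answered_Suc[OF \<sigma> i]) (auto simp: \<tau>'_def \<sigma>\<^sub>1_def area_Suc P_def[symmetric])
    moreover have "1 \<le> n * n" using n_pos by simp
    \<comment> \<open>50 steps cover the statements and the test before the branch, 11 the two
      assignments after it.\<close>
    then have "50 + (t + 11) \<le> 700 * (n * n)" using t by linarith
    ultimately show "wp W ?rest (\<lambda>t' \<tau>. 50 + (t + t') \<le> 700 * (n * n) \<and> answered (i + 1) \<tau>) \<tau>"
      using r\<tau> bounds by (simp add: \<tau>'_def)
  qed
  then show ?thesis
    unfolding answer_pair_def
      wp_Seq[of _ "Assign 7 _"] wp_Seq[of _ "Assign 8 _"] wp_Seq[of _ "Assign 9 _"]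
      wp_Seq[of _ "Store _ _"] wp_Seq[of _ "If _ _ _"]
    using r args bounds \<open>u < n\<close> \<open>v < n\<close> i
    by (auto simp: \<sigma>\<^sub>1_def fun_upd_def mult_2[symmetric] simp del: wp_Seq split del: if_split
        elim!: wp_mono)
qed

end


lemma (in lca_instance) wp_lca_program:
  "wp W lca_program
    (\<lambda>t \<tau>. t \<le> 1000 * (n * n * k) + 50 * m + 100 \<and>
      (\<forall>i<k. stored_list \<tau> (mem \<tau> (reg \<tau> 0 + i)) = pair_answer n (set as) (ps ! i)))
    (initial_state [n, m, k] (flatten_pairs (as @ ps)))" (is "wp _ _ _ ?\<sigma>")
proof -
  let ?post = "\<lambda>\<tau>. \<forall>i<k. stored_list \<tau> (mem \<tau> (reg \<tau> 0 + i)) = pair_answer n (set as) (ps ! i)"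
  have regs: "reg ?\<sigma> 0 = n" "reg ?\<sigma> 1 = m" "reg ?\<sigma> 2 = k"
    by (auto simp: initial_state_def)
  have mem_arc: "mem ?\<sigma> (2 * i) = fst (as ! i) \<and> mem ?\<sigma> (2 * i + 1) = snd (as ! i)" if "i < m" for i
    using that by (simp add: initial_state_def flatten_pairs_nth nth_append)
  have mem_pair: "mem ?\<sigma> (2 * m + 2 * j) = fst (ps ! j) \<and> mem ?\<sigma> (2 * m + 2 * j + 1) = snd (ps ! j)"
    if "j < k" for j
    using that flatten_pairs_nth[of "m + j" "as @ ps"]
    by (simp add: initial_state_def nth_append algebra_simps)
  have fresh: "\<forall>a\<ge>A. mem ?\<sigma> a = 0"
    by (simp add: initial_state_def)
  have bounds: "A + n * n + n + 4 \<le> W" "table + k \<le> W"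
    using W_ge by auto
  let ?loop = "While (Bin Less (Reg 5) (Reg 2)) answer_pair"
  have loop: "wp W (?loop ;; Assign 0 (Reg 4))
    (\<lambda>t \<tau>. t \<le> 1000 * (n * n * k) + 10 \<and> ?post \<tau>) \<sigma>'"
    if "answered 0 \<sigma>'" for \<sigma>'
    unfolding wp_Seq
  proof (rule wp_While_less[where I = "\<lambda>\<tau>. \<exists>i\<le>k. answered i \<tau>" and
        f = "\<lambda>\<tau>. k - reg \<tau> 5" and K = "700 * (n * n)"])
    show "\<exists>i\<le>k. answered i \<sigma>'" using that by blast
  next
    fix \<tau> assume "\<exists>i\<le>k. answered i \<tau>"
    then show "exp_fits W (Reg 5) \<tau> \<and> exp_fits W (Reg 2) \<tau>"
      using bounds by (auto simp: answered_def)
  next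
    fix \<tau> assume "\<exists>i\<le>k. answered i \<tau>" and g: "exp_val (Reg 5) \<tau> < exp_val (Reg 2) \<tau>"
    then obtain i where i: "answered i \<tau>" by blast
    then have "reg \<tau> 5 = i" "i < k" using g by (auto simp: answered_def)
    show "wp W answer_pair
      (\<lambda>t \<tau>'. t \<le> 700 * (n * n) \<and> (\<exists>i\<le>k. answered i \<tau>') \<and> k - reg \<tau>' 5 < k - reg \<tau> 5) \<tau>"
    proof (rule wp_mono[OF wp_answer_pair[OF i \<open>i < k\<close>]])
      fix t \<tau>' assume *: "t \<le> 700 * (n * n) \<and> answered (i + 1) \<tau>'"
      then have "reg \<tau>' 5 = i + 1" by (simp add: answered_def)
      then show "t \<le> 700 * (n * n) \<and> (\<exists>i\<le>k. answered i \<tau>') \<and> k - reg \<tau>' 5 < k - reg \<tau> 5"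
        using * \<open>reg \<tau> 5 = i\<close> \<open>i < k\<close> by (auto intro!: exI[of _ "i + 1"])
    qed
  next
    fix t \<tau>
    assume "\<exists>i\<le>k. answered i \<tau>" and ge: "exp_val (Reg 2) \<tau> \<le> exp_val (Reg 5) \<tau>"
      and t: "t \<le> (k - reg \<sigma>' 5) * (700 * (n * n) + exp_cost (Reg 5) + exp_cost (Reg 2) + 2)
        + exp_cost (Reg 5) + exp_cost (Reg 2) + 2"
    then obtain i where i: "answered i \<tau>" "i \<le> k" by blast
    then have "i = k" using ge by (auto simp: answered_def)
    \<comment> \<open>The \<open>4 * k\<close> steps spent on the guard disappear in the constant
      because \<open>k \<le> n * n * k\<close>.\<close>
    have "t \<le> 700 * (n * n * k) + 4 * k + 4"
      using t that by (simp add: answered_def algebra_simps)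
    moreover have "k \<le> n * n * k"
      using n_pos by simp
    ultimately have time: "t + 2 \<le> 1000 * (n * n * k) + 10"
      by linarith
    define \<tau>' where "\<tau>' = \<tau>\<lparr>reg := (reg \<tau>)(0 := table)\<rparr>"
    have "stored_list \<tau>' p = stored_list \<tau> p" for p
      by (rule stored_list_cong) (simp add: \<tau>'_def)
    then have "?post \<tau>'"
      using i(1) \<open>i = k\<close> by (simp add: \<tau>'_def answered_def)
    then show "wp W (Assign 0 (Reg 4)) (\<lambda>t' \<tau>. t + t' \<le> 1000 * (n * n * k) + 10 \<and> ?post \<tau>) \<tau>"
      using time i(1) bounds by (simp add: \<tau>'_def answered_def)
  qed (use bounds in simp)
  let ?rest = "Assign 4 (Reg 3 \<^bold>+ Reg 0 \<^bold>* Reg 0) ;; Assign 5 (Const 0) ;;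
    Assign 6 (Reg 4 \<^bold>+ Reg 2) ;; ?loop ;; Assign 0 (Reg 4)"
  have "wp W build_matrix (\<lambda>t \<tau>. t \<le> 50 * m + 30 \<and>
    (\<forall>r<10. r \<noteq> 3 \<longrightarrow> reg \<tau> r = reg ?\<sigma> r) \<and> reg \<tau> 3 = A \<and> (\<forall>a<A. mem \<tau> a = mem ?\<sigma> a) \<and>
    (\<forall>a\<ge>A + n * n. mem \<tau> a = 0) \<and> has_matrix n (set as) A (mem \<tau>)) ?\<sigma>"
    using regs mem_arc fresh bounds dag_input_arcs_subset[OF input(1)]
    by (intro wp_build_matrix[where k = k]) auto
  then show ?thesis
    unfolding lca_program_def wp_Seq[of _ build_matrix]
  proof (rule wp_mono, elim conjE)
    fix t and \<tau> :: state
    assume t: "t \<le> 50 * m + 30" and \<tau>: "\<forall>r<10. r \<noteq> 3 \<longrightarrow> reg \<tau> r = reg ?\<sigma> r" "reg \<tau> 3 = A"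
      "\<forall>a<A. mem \<tau> a = mem ?\<sigma> a" "\<forall>a\<ge>A + n * n. mem \<tau> a = 0" "has_matrix n (set as) A (mem \<tau>)"
    have r: "reg \<tau> 0 = n" "reg \<tau> 1 = m" "reg \<tau> 2 = k"
      using \<tau>(1) regs by auto
    define \<tau>' where "\<tau>' = \<tau>\<lparr>reg := (reg \<tau>)(4 := table, 5 := 0, 6 := table + k)\<rparr>"
    have "answered 0 \<tau>'"
      using \<tau> r mem_pair unfolding answered_def by (auto simp: \<tau>'_def area_def)
    then have "wp W (?loop ;; Assign 0 (Reg 4)) (\<lambda>t' \<tau>''. t + (50 + t') \<le> 1000 * (n * n * k) + 50 * m + 100 \<and> ?post \<tau>'') \<tau>'"
      by (rule wp_mono[OF loop]) (use t in auto)
    then show "wp W ?rest (\<lambda>t' \<tau>. t + t' \<le> 1000 * (n * n * k) + 50 * m + 100 \<and> ?post \<tau>) \<tau>"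
      unfolding wp_Seq[of _ "Assign 4 _"] wp_Seq[of _ "Assign 5 _"] wp_Seq[of _ "Assign 6 _"]
      using r \<tau>(2) bounds
      by (auto simp: \<tau>'_def simp del: wp_Seq elim!: wp_mono)
  qed
qed

section \<open>The time bound\<close>

lemma exec_time_pos: "exec W c \<sigma> t \<tau> \<Longrightarrow> 1 \<le> t"
  by (induction rule: exec.induct) auto

text \<open>Arcless graphs of growing size are valid instances, and for \<open>\<omega> < 0\<close>
  the allowed time \<open>C * real n powr \<omega>\<close> would tend to 0 on them, falling below
  the one step that every run takes.\<close>

lemma transitive_closure_exponent_nonneg:
  fixes \<omega> :: real
  assumes "transitive_closure_in_time (\<lambda>n. real n powr \<omega>)"
  shows "0 \<le> \<omega>"
proof (rule ccontr)
  assume "\<not> 0 \<le> \<omega>"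
  then have lim: "(\<lambda>n. real n powr \<omega>) \<longlonglongrightarrow> 0"
    by (intro tendsto_neg_powr filterlim_real_sequentially) simp
  obtain prog w d and C :: real where run: "\<And>n as. dag_input n as \<Longrightarrow>
      \<exists>t \<tau>. exec (w * (n + length as + 1) ^ d) prog (initial_state [n, length as] (flatten_pairs as)) t \<tau> \<and>
        real t \<le> C * real n powr \<omega>"
    using assms unfolding transitive_closure_in_time_def solvable_in_time_def by fastforce
  have "1 \<le> C * real n powr \<omega>" if "0 < n" for n
    using run[OF dag_input_Nil[OF that]] exec_time_pos by fastforce
  then have "\<forall>\<^sub>F n in sequentially. 1 \<le> C * real n powr \<omega>"
    by (intro eventually_mono[OF eventually_gt_at_top[of 0]])
  moreover have "(\<lambda>n. C * real n powr \<omega>) \<longlonglongrightarrow> C * 0"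
    by (intro tendsto_intros lim)
  ultimately have "(1 :: real) \<le> C * 0"
    by (intro tendsto_lowerbound) auto
  then show False by simp
qed

text \<open>The terms of highest degree are \<open>n * n\<close> and \<open>5 * n * k\<close>, so a
  square suffices; after expansion the factor 10 dominates every coefficient.\<close>

lemma word_bound:
  "2 * (m + k) + n * n + k + k * (5 * n + 1) + n + 4 \<le> 10 * (n + m + k + 1) ^ 2" for n m k :: nat
  by (simp add: power2_eq_square algebra_simps)

theorem mainTheorem3:
  fixes \<omega> :: real
  assumes "transitive_closure_in_time (\<lambda>n. real n powr \<omega>)"
  shows "all_lcas_in_time (\<lambda>n m k.
    real n powr \<omega> + real n * (real m + real k) + (real n)\<^sup>2 * real k)"
proof -
  have solves: "\<exists>t \<tau>. exec (10 * (n + length as + length ps + 1) ^ 2) lca_program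
        (initial_state [n, length as, length ps] (flatten_pairs (as @ ps))) t \<tau> \<and>
      (\<forall>i<length ps. let xs = stored_list \<tau> (mem \<tau> (reg \<tau> 0 + i)); (u, v) = ps ! i
          in distinct xs \<and> set xs = {s. lca (arc_digraph n as) u v s}) \<and>
      real t \<le> 1000 * (real n powr \<omega> + real n * (real (length as) + real (length ps)) +
        (real n)\<^sup>2 * real (length ps))"
    if valid: "dag_input n as" "set ps \<subseteq> {..<n} \<times> {..<n}" for n as ps
  proof -
    interpret lca_instance n "10 * (n + length as + length ps + 1) ^ 2" as ps
      using valid word_bound by unfold_locales
    obtain t \<tau> where run: "exec (10 * (n + m + k + 1) ^ 2) lca_program
        (initial_state [n, m, k] (flatten_pairs (as @ ps))) t \<tau>"
      and t: "t \<le> 1000 * (n * n * k) + 50 * m + 100"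
      and answers: "\<forall>i<k. stored_list \<tau> (mem \<tau> (reg \<tau> 0 + i)) = pair_answer n (set as) (ps ! i)"
      using wp_lca_program unfolding wp_def by blast
    have "let xs = stored_list \<tau> (mem \<tau> (reg \<tau> 0 + i)); (u, v) = ps ! i
          in distinct xs \<and> set xs = {s. lca (arc_digraph n as) u v s}" if "i < k" for i
    proof -
      obtain u v where uv: "ps ! i = (u, v)" by fastforce
      then have "u < n" "v < n"
        using valid(2) nth_mem[OF that] by auto
      then show ?thesis
        using answers that uv pair_answer_correct[OF valid(1)] by (simp add: Let_def)
    qed
    \<comment> \<open>Each part of the running time is charged to one summand: the constant 100 to
      \<open>real n powr \<omega>\<close>, \<open>50 * m\<close> to the middle one, the loop to the
      last. The largest of the three factors is 1000.\<close>
    moreover have "1 \<le> real n powr \<omega>"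
      using transitive_closure_exponent_nonneg[OF assms] n_pos by (simp add: ge_one_powr_ge_zero)
    moreover have "m \<le> n * (m + k)"
      using n_pos by (metis le_add1 le_trans mult_le_mono1 nat_mult_1 Suc_leI One_nat_def)
    then have "real m \<le> real n * (real m + real k)"
      by (metis of_nat_add of_nat_le_iff of_nat_mult)
    moreover have "real t \<le> 1000 * ((real n)\<^sup>2 * real k) + 50 * real m + 100"
      using of_nat_mono[OF t, where 'a = real] by (simp add: power2_eq_square)
    ultimately show ?thesis
      using run by (intro exI[of _ t] exI[of _ \<tau>] conjI) auto
  qed
  show ?thesis
    unfolding all_lcas_in_time_def solvable_in_time_def
  proof (rule exI[of _ lca_program], rule exI[of _ 10], rule exI[of _ 2], rule exI[of _ 1000],
      intro allI impI)
    fix I :: "nat \<times> (nat \<times> nat) list \<times> (nat \<times> nat) list"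
    assume valid: "case I of (n, as, ps) \<Rightarrow> dag_input n as \<and> set ps \<subseteq> {..<n} \<times> {..<n}"
    obtain n as ps where I: "I = (n, as, ps)" by (cases I)
    show "\<exists>t \<tau>.
      exec (10 * ((case I of (n, as, ps) \<Rightarrow> n + length as + length ps) + 1) ^ 2) lca_program
        (case I of (n, as, ps) \<Rightarrow> initial_state [n, length as, length ps] (flatten_pairs (as @ ps))) t \<tau> \<and>
      (case I of (n, as, ps) \<Rightarrow> \<lambda>\<tau>. \<forall>i<length ps.
        let xs = stored_list \<tau> (mem \<tau> (reg \<tau> 0 + i)); (u, v) = ps ! i
          in distinct xs \<and> set xs = {s. lca (arc_digraph n as) u v s}) \<tau> \<and>
      real t \<le> 1000 * (case I of (n, as, ps) \<Rightarrow>
        real n powr \<omega> + real n * (real (length as) + real (length ps)) + (real n)\<^sup>2 * real (length ps))"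
      using solves[of n as ps] valid unfolding I prod.case by blast
  qed
qed

end
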